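(* Let $R_0=\min_{x^\star\in X^*}\|x^0-x^\star\|_L$, let $F^\star$ be the optimal value of $\min_{x\in\mathbb{R}^N}F(x)$, and let $\{x^k\}$ be the sequence generated by the RBCD method started at $x^0$. Then for any $k\ge 0$, the iterate $x^k$ satisfies $$\mathbf{E}_{\xi_{k-1}}\bigl[F(x^k)\bigr]-F^\star\ \le\ \frac{n}{n+k}\left(\frac12R_0^2+F(x^0)-F^\star\right).$$ Furthermore, if at least one of $f$ and $\Psi$ is strongly convex, i.e., $\mu_f+\mu_\Psi>0$, then for any $k\ge 0$ $$\mathbf{E}_{\xi_{k-1}}\bigl[F(x^k)\bigr]-F^\star\ \le\ \left(1-\frac{2(\mu_f+\mu_\Psi)}{n(1+\mu_f+2\mu_\Psi)}\right)^k\left(\frac{1+\mu_\Psi}{2}R_0^2+F(x^0)-F^\star\right).$$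
   Context: Block structure: $x\in\mathbb{R}^N$ is partitioned into $n$ blocks $x_i\in\mathbb{R}^{N_i}$, $i=1,\dots,n$. There is an $N\times N$ permutation matrix $U=[U_1\cdots U_n]$, $U_i\in\mathbb{R}^{N\times N_i}$, with $x=\sum_{i=1}^nU_ix_i$ and $x_i=U_i^Tx$. Each $\mathbb{R}^{N_i}$ carries the standard Euclidean norm $\|\cdot\|$. Problem: $\min_{x\in\mathbb{R}^N}F(x)$ with $F(x)=f(x)+\Psi(x)$, where $f:\mathbb{R}^N\to\mathbb{R}$ is convex and differentiable, $\Psi(x)=\sum_{i=1}^n\Psi_i(x_i)$, and each $\Psi_i:\mathbb{R}^{N_i}\to\mathbb{R}\cup\{+\infty\}$ is a closed convex function. The problem has a minimum: its optimal value $F^\star$ is finite ($F^\star>-\infty$) and its set of optimal solutions $X^*$ is nonempty. With $\nabla_if(x)=U_i^T\nabla f(x)$, the gradient is block-wise Lipschitz with constants $L_i>0$: $\|\nabla_if(x+U_ih_i)-\nabla_if(x)\|\le L_i\|h_i\|$ for all $x\in\mathbb{R}^N$, $h_i\in\mathbb{R}^{N_i}$, $i=1,\dots,n$. Norm: $\|x\|_L=\bigl(\sum_{i=1}^nL_i\|x_i\|^2\bigr)^{1/2}$. Convexity parameter: for convex $\phi:\mathbb{R}^N\to\mathbb{R}\cup\{+\infty\}$, $\mu_\phi$ is the largest $\mu\ge0$ such that $\phi(y)\ge\phi(x)+\langle s,y-x\rangle+\frac{\mu}{2}\|y-x\|_L^2$ for all $x,y\in\mathrm{dom}\,\phi$ and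 all $s\in\partial\phi(x)$; $\phi$ is strongly convex iff $\mu_\phi>0$. $\mu_f\ge0$ and $\mu_\Psi\ge0$ denote the convexity parameters of $f$ and $\Psi$. RBCD method: define $d_i(x)=\arg\min_{d_i\in\mathbb{R}^{N_i}}\{\langle\nabla_if(x),d_i\rangle+\frac{L_i}{2}\|d_i\|^2+\Psi_i(x_i+d_i)\}$. Given an initial point $x^0\in\mathbb{R}^N$, for $k=0,1,2,\dots$ choose $i_k\in\{1,\dots,n\}$ uniformly at random (independently across iterations) and set $x^{k+1}=x^k+U_{i_k}d_{i_k}(x^k)$. Write $\xi_{k-1}=\{i_0,\dots,i_{k-1}\}$; $\mathbf{E}_{\xi_{k-1}}$ is expectation over $\xi_{k-1}$ (for $k=0$ it leaves the deterministic quantity unchanged). *)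

theory Defs
  imports "HOL-Probability.Probability"
begin

text \<open>
  The space \<open>R^N\<close> is \<^typ>\<open>real ^ 'm\<close>, and the blocks are indexed by a finite type \<open>'n\<close>.
  The block partition is an arbitrary map \<open>blk :: 'm \<Rightarrow> 'n\<close>: the matrix \<open>U_i\<close> consists of the
  unit vectors \<open>e_j\<close> with \<open>blk j = i\<close>, and \<open>N_i\<close> is the number of these \<open>j\<close>.
  Since the \<open>N_i\<close> vary with \<open>i\<close>, the space \<open>R^{N_i}\<close> is represented by its isometric image under
  \<open>U_i\<close>, the coordinate subspace \<open>block_space blk i\<close>. With this identification \<open>U_i\<close> is the
  inclusion of \<open>block_space blk i\<close> and \<open>U_i^T\<close> is the projection \<open>block blk i\<close>.
\<close>

definition block_space :: "('m::finite \<Rightarrow> 'n) \<Rightarrow> 'n \<Rightarrow> (real ^ 'm) set" where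
  "block_space blk i = {x. \<forall>j. blk j \<noteq> i \<longrightarrow> x $ j = 0}"

definition block :: "('m::finite \<Rightarrow> 'n) \<Rightarrow> 'n \<Rightarrow> real ^ 'm \<Rightarrow> real ^ 'm" where
  "block blk i x = (\<chi> j. if blk j = i then x $ j else 0)"

definition norm_L :: "('m::finite \<Rightarrow> 'n::finite) \<Rightarrow> ('n \<Rightarrow> real) \<Rightarrow> real ^ 'm \<Rightarrow> real" where
  "norm_L blk L x = sqrt (\<Sum>i\<in>UNIV. L i * (norm (block blk i x))\<^sup>2)"

text \<open>A function is only looked at on \<open>S\<close>; its values outside \<open>S\<close> are irrelevant.\<close>

definition closed_convex_fun_on :: "'a::euclidean_space set \<Rightarrow> ('a \<Rightarrow> ereal) \<Rightarrow> bool" where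
  "closed_convex_fun_on S \<phi> \<longleftrightarrow>
     (\<forall>x\<in>S. \<phi> x \<noteq> -\<infinity>) \<and>
     closed {(x, t::real). x \<in> S \<and> \<phi> x \<le> ereal t} \<and>
     convex {(x, t::real). x \<in> S \<and> \<phi> x \<le> ereal t}"

definition edom :: "('a \<Rightarrow> ereal) \<Rightarrow> 'a set" where
  "edom \<phi> = {x. \<phi> x < \<infinity>}"

definition subdifferential :: "('a::real_inner \<Rightarrow> ereal) \<Rightarrow> 'a \<Rightarrow> 'a set" where
  "subdifferential \<phi> x = {s. \<forall>y. \<phi> y \<ge> \<phi> x + ereal (inner s (y - x))}"

definition strong_convexity_ineq ::
  "('m::finite \<Rightarrow> 'n::finite) \<Rightarrow> ('n \<Rightarrow> real) \<Rightarrow> (real ^ 'm \<Rightarrow> ereal) \<Rightarrow> real \<Rightarrow> bool" where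
  "strong_convexity_ineq blk L \<phi> \<mu> \<longleftrightarrow>
     (\<forall>x\<in>edom \<phi>. \<forall>y\<in>edom \<phi>. \<forall>s\<in>subdifferential \<phi> x.
        \<phi> y \<ge> \<phi> x + ereal (inner s (y - x)) + ereal (\<mu> / 2 * (norm_L blk L (y - x))\<^sup>2))"

text \<open>
  A predicate rather than a function, because no largest \<open>\<mu>\<close> exists when the domain of \<open>\<phi>\<close> is a
  single point.
\<close>

definition is_convexity_parameter ::
  "('m::finite \<Rightarrow> 'n::finite) \<Rightarrow> ('n \<Rightarrow> real) \<Rightarrow> (real ^ 'm \<Rightarrow> ereal) \<Rightarrow> real \<Rightarrow> bool" where
  "is_convexity_parameter blk L \<phi> \<mu> \<longleftrightarrow>
     0 \<le> \<mu> \<and> strong_convexity_ineq blk L \<phi> \<mu> \<and>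
     (\<forall>\<mu>'\<ge>0. strong_convexity_ineq blk L \<phi> \<mu>' \<longrightarrow> \<mu>' \<le> \<mu>)"

definition gradient :: "('a::euclidean_space \<Rightarrow> real) \<Rightarrow> 'a \<Rightarrow> 'a" where
  "gradient f x = (THE g. GDERIV f x :> g)"

definition block_sum ::
  "('m::finite \<Rightarrow> 'n::finite) \<Rightarrow> ('n \<Rightarrow> real ^ 'm \<Rightarrow> ereal) \<Rightarrow> real ^ 'm \<Rightarrow> ereal" where
  "block_sum blk \<psi> x = (\<Sum>i\<in>UNIV. \<psi> i (block blk i x))"

definition objective ::
  "('m::finite \<Rightarrow> 'n::finite) \<Rightarrow> (real ^ 'm \<Rightarrow> real) \<Rightarrow> ('n \<Rightarrow> real ^ 'm \<Rightarrow> ereal) \<Rightarrow>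
     real ^ 'm \<Rightarrow> ereal" where
  "objective blk f \<psi> x = ereal (f x) + block_sum blk \<psi> x"

definition opt_value :: "('a \<Rightarrow> ereal) \<Rightarrow> ereal" where
  "opt_value F = (INF x. F x)"

definition opt_solutions :: "('a \<Rightarrow> ereal) \<Rightarrow> 'a set" where
  "opt_solutions F = {x. F x = opt_value F}"

definition block_step ::
  "('m::finite \<Rightarrow> 'n::finite) \<Rightarrow> ('n \<Rightarrow> real) \<Rightarrow> (real ^ 'm \<Rightarrow> real) \<Rightarrow>
     ('n \<Rightarrow> real ^ 'm \<Rightarrow> ereal) \<Rightarrow> 'n \<Rightarrow> real ^ 'm \<Rightarrow> real ^ 'm" where
  "block_step blk L f \<psi> i x =
     arg_min_on
       (\<lambda>d. ereal (inner (block blk i (gradient f x)) d + L i / 2 * (norm d)\<^sup>2)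
             + \<psi> i (block blk i x + d))
       (block_space blk i)"

primrec rbcd ::
  "('m::finite \<Rightarrow> 'n::finite) \<Rightarrow> ('n \<Rightarrow> real) \<Rightarrow> (real ^ 'm \<Rightarrow> real) \<Rightarrow>
     ('n \<Rightarrow> real ^ 'm \<Rightarrow> ereal) \<Rightarrow> real ^ 'm \<Rightarrow> (nat \<Rightarrow> 'n) \<Rightarrow> nat \<Rightarrow> real ^ 'm" where
  "rbcd blk L f \<psi> x0 \<iota> 0 = x0"
| "rbcd blk L f \<psi> x0 \<iota> (Suc k) =
     rbcd blk L f \<psi> x0 \<iota> k + block_step blk L f \<psi> (\<iota> k) (rbcd blk L f \<psi> x0 \<iota> k)"

text \<open>
  Expectation of an extended-real random variable, as the difference of the expectations of its
  positive and negative parts (\<^const>\<open>e2ennreal\<close> maps negative values to 0). An extended value is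
  needed because the objective may be infinite at the initial point.
\<close>

definition ereal_expectation :: "'w measure \<Rightarrow> ('w \<Rightarrow> ereal) \<Rightarrow> ereal" where
  "ereal_expectation M X =
     enn2ereal (\<integral>\<^sup>+ \<omega>. e2ennreal (X \<omega>) \<partial>M) - enn2ereal (\<integral>\<^sup>+ \<omega>. e2ennreal (- X \<omega>) \<partial>M)"

end

theory Submission
  imports Defs
begin

text \<open>
  Fix a point \<open>x\<close>, let \<open>d\<close> be the sum of all block steps at \<open>x\<close>, and let
  \<open>H = f x + \<langle>\<nabla>f(x), d\<rangle> + \<parallel>d\<parallel>\<^sub>L\<^sup>2/2 + \<Psi>(x + d)\<close> be the value of the separable quadratic model at its
  minimiser (\<open>model_value\<close>). The model plays two roles.

  It is an upper bound on average progress: the descent lemma for each block shows that updating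
  one uniformly chosen block changes \<open>F\<close> by at most \<open>(H - F x)/n\<close> in expectation
  (\<open>sum_F_after_step\<close>). It is also almost a lower bound for \<open>F\<close>: optimality of the block steps says that
  \<open>- \<nabla>f(x) - L d\<close> is a subgradient of \<open>\<Psi>\<close> at \<open>x + d\<close>, so (strong) convexity of \<open>f\<close> at \<open>x\<close> and of
  \<open>\<Psi>\<close> at \<open>x + d\<close> bounds \<open>F y\<close> below by \<open>H + \<parallel>d\<parallel>\<^sub>L\<^sup>2/2 - \<langle>d, y - x\<rangle>\<^sub>L\<close> plus quadratic terms
  (\<open>model_lower_bound\<close>).

  At a minimiser \<open>y = xs\<close> the terms \<open>\<parallel>d\<parallel>\<^sub>L\<^sup>2/2 - \<langle>d, xs - x\<rangle>\<^sub>L\<close> are exactly \<open>n\<close> times the expected change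
  of \<open>\<parallel>x - xs\<parallel>\<^sub>L\<^sup>2/2\<close>. Adding the two bounds cancels \<open>H\<close>, and
  \<open>V x = (1 + \<mu>\<^sub>\<Psi>)/2 \<parallel>x - xs\<parallel>\<^sub>L\<^sup>2 + F x - F\<^sup>*\<close> decreases in expectation by at least
  \<open>((\<mu>\<^sub>f + \<mu>\<^sub>\<Psi>)/2 \<parallel>x - xs\<parallel>\<^sub>L\<^sup>2 + F x - F\<^sup>*)/n\<close> (\<open>potential_step\<close>).

  With both parameters replaced by zero, the decreases \<open>(F x - F\<^sup>*)/n\<close> are summed; \<open>F\<close> never increases
  along the iteration, so the last gap is the smallest and the sublinear rate follows. With
  \<open>\<mu>\<^sub>f + \<mu>\<^sub>\<Psi> > 0\<close>, quadratic growth \<open>F x - F\<^sup>* \<ge> (\<mu>\<^sub>f + \<mu>\<^sub>\<Psi>)/2 \<parallel>x - xs\<parallel>\<^sub>L\<^sup>2\<close> shows that the decrease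
  is at least \<open>\<beta> V x / n\<close> with \<open>\<beta> = 2(\<mu>\<^sub>f + \<mu>\<^sub>\<Psi>)/(1 + \<mu>\<^sub>f + 2\<mu>\<^sub>\<Psi>)\<close>, which is the linear rate.

  If \<open>F\<close> is infinite at the initial point, the right-hand sides are infinite, with one exception:
  for a single block and \<open>\<mu>\<^sub>f = 1\<close> the contraction factor is 0, and
  \<open>0 \<cdot> \<infinity> = 0\<close> makes the bound 0 from the first step on. In this case the
  model is exact, so one step reaches a minimiser (\<open>single_block_exact_step\<close>).
\<close>

section \<open>Blocks\<close>

lemma block_nth [simp]: "block blk i x $ j = (if blk j = i then x $ j else 0)"
  by (simp add: block_def)

lemma block_in_block_space [simp]: "block blk i x \<in> block_space blk i"
  by (simp add: block_space_def)

lemma block_of_block_space [simp]: "x \<in> block_space blk i \<Longrightarrow> block blk i x = x"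
  by (auto simp: block_space_def vec_eq_iff)

lemma block_of_other_block_space: "x \<in> block_space blk i \<Longrightarrow> j \<noteq> i \<Longrightarrow> block blk j x = 0"
  by (auto simp: block_space_def vec_eq_iff)

lemma linear_block: "linear (block blk i)"
  by (rule linearI) (auto simp: vec_eq_iff)

lemmas block_add = linear_add[OF linear_block]
  and block_diff = linear_diff[OF linear_block]
  and block_0 = linear_0[OF linear_block]

lemma subspace_block_space: "subspace (block_space blk i)"
  by (auto simp: subspace_def block_space_def)

lemmas block_space_0 = subspace_0[OF subspace_block_space]
  and block_space_add = subspace_add[OF subspace_block_space]
  and block_space_diff = subspace_diff[OF subspace_block_space]
  and block_space_scale = subspace_scale[OF subspace_block_space]

lemma block_sum_vectors:
  fixes d :: "'n::finite \<Rightarrow> real ^ 'm"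
  assumes "\<And>j. d j \<in> block_space blk j"
  shows "block blk i (\<Sum>j\<in>UNIV. d j) = d i"
proof -
  have "block blk i (\<Sum>j\<in>UNIV. d j) = (\<Sum>j\<in>UNIV. block blk i (d j))"
    by (rule linear_sum[OF linear_block])
  also have "\<dots> = (\<Sum>j\<in>UNIV. if j = i then d i else 0)"
    using assms block_of_other_block_space[OF assms] by (intro sum.cong) auto
  finally show ?thesis by simp
qed

lemma sum_blocks: "(\<Sum>i\<in>UNIV. block blk i x) = x" for blk :: "'m::finite \<Rightarrow> 'n::finite"
  by (auto simp: vec_eq_iff)

lemma inner_block_left: "inner (block blk i x) y = inner (block blk i x) (block blk i y)"
  unfolding inner_vec_def by (rule sum.cong) auto

lemma inner_block_commute: "inner (block blk i x) y = inner x (block blk i y)"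
  by (metis inner_block_left inner_commute)

lemma inner_sum_blocks:
  "inner x y = (\<Sum>i\<in>UNIV. inner (block blk i x) (block blk i y))"
  for blk :: "'m::finite \<Rightarrow> 'n::finite"
proof -
  have "inner x y = inner (\<Sum>i\<in>UNIV. block blk i x) y" by (simp add: sum_blocks)
  also have "\<dots> = (\<Sum>i\<in>UNIV. inner (block blk i x) y)" by (rule inner_sum_left)
  finally show ?thesis by (simp add: inner_block_left[symmetric])
qed

lemma inner_block_space: "d \<in> block_space blk i \<Longrightarrow> inner x d = inner (block blk i x) d"
  by (metis block_of_block_space inner_block_commute)

text \<open>
  The inner product whose norm is \<^const>\<open>norm_L\<close>; expanding squares of that norm bilinearly is what
  the estimates below need.
\<close>

definition inner_L :: "('m::finite \<Rightarrow> 'n::finite) \<Rightarrow> ('n \<Rightarrow> real) \<Rightarrow> real ^ 'm \<Rightarrow> real ^ 'm \<Rightarrow> real"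
  where "inner_L blk L x y = (\<Sum>i\<in>UNIV. L i * inner (block blk i x) (block blk i y))"

lemma inner_L_add_left: "inner_L blk L (x + y) z = inner_L blk L x z + inner_L blk L y z"
  by (simp add: inner_L_def block_add inner_add_left algebra_simps sum.distrib)

lemma inner_L_diff_left: "inner_L blk L (x - y) z = inner_L blk L x z - inner_L blk L y z"
  by (simp add: inner_L_def block_diff inner_diff_left algebra_simps sum_subtractf)

lemma inner_L_commute: "inner_L blk L x y = inner_L blk L y x"
  by (simp add: inner_L_def inner_commute)

lemma inner_L_add_right: "inner_L blk L z (x + y) = inner_L blk L z x + inner_L blk L z y"
  by (metis inner_L_add_left inner_L_commute)

lemma inner_L_diff_right: "inner_L blk L z (x - y) = inner_L blk L z x - inner_L blk L z y"
  by (metis inner_L_diff_left inner_L_commute)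

lemma norm_L_sq:
  assumes "\<And>i. L i > 0"
  shows "(norm_L blk L x)\<^sup>2 = inner_L blk L x x"
  using assms by (simp add: norm_L_def inner_L_def power2_norm_eq_inner sum_nonneg less_imp_le)

lemma inner_L_block_space:
  assumes "d \<in> block_space blk i"
  shows "inner_L blk L x d = L i * inner (block blk i x) d"
proof -
  have "inner_L blk L x d = (\<Sum>j\<in>UNIV. if j = i then L i * inner (block blk i x) d else 0)"
    unfolding inner_L_def
    by (rule sum.cong) (use assms in \<open>auto simp: block_of_other_block_space\<close>)
  then show ?thesis by simp
qed

section \<open>Gradients\<close>

lemma GDERIV_gradient:
  assumes "f differentiable_on UNIV"
  shows "GDERIV f x :> gradient f x"
proof -
  obtain f' where f': "(f has_derivative f') (at x)"
    using assms by (auto simp: differentiable_on_def differentiable_def)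
  have "linear f'" using f' has_derivative_linear by blast
  define g where "g = (\<Sum>b\<in>Basis. f' b *\<^sub>R b)"
  have "f' h = inner h g" for h
  proof -
    have "f' h = f' (\<Sum>b\<in>Basis. inner h b *\<^sub>R b)" by (simp add: euclidean_representation)
    also have "\<dots> = (\<Sum>b\<in>Basis. inner h b * f' b)"
      using \<open>linear f'\<close> by (simp add: linear_sum linear_scale)
    finally show ?thesis by (simp add: g_def inner_sum_right mult.commute)
  qed
  then have g: "GDERIV f x :> g"
    using f' unfolding gderiv_def by (metis ext)
  have "g' = g" if "GDERIV f x :> g'" for g'
  proof -
    have "(\<lambda>h. inner h g') = (\<lambda>h. inner h g)"
      using that g has_derivative_unique unfolding gderiv_def by blast
    then show ?thesis by (metis vector_eq_ldot)
  qed
  with g show ?thesis unfolding gradient_def by (rule theI[where P = "\<lambda>g. GDERIV f x :> g"])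
qed

lemma DERIV_along_line:
  assumes "f differentiable_on UNIV"
  shows "((\<lambda>t. f (x + t *\<^sub>R h)) has_real_derivative inner (gradient f (x + t *\<^sub>R h)) h) (at t)"
proof -
  have "((\<lambda>t. x + t *\<^sub>R h) has_derivative (\<lambda>t. t *\<^sub>R h)) (at t)"
    by (auto intro!: derivative_eq_intros)
  from diff_chain_at[OF this GDERIV_gradient[OF assms, unfolded gderiv_def]]
  show ?thesis
    by (simp add: has_field_derivative_def o_def inner_commute mult_commute_abs)
qed

text \<open>
  Restricting \<open>f\<close> to the line through \<open>x\<close> and \<open>y\<close> reduces this to the tangent inequality for convex
  functions of one real variable.
\<close>

lemma convex_above_gradient:
  assumes "f differentiable_on UNIV" "convex_on UNIV f"
  shows "f y \<ge> f x + inner (gradient f x) (y - x)"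
proof -
  define g where "g t = f (x + t *\<^sub>R (y - x))" for t :: real
  have "convex_on UNIV g"
  proof (rule convex_onI)
    fix t a b :: real assume "0 < t" "t < 1"
    have "x + ((1 - t) *\<^sub>R a + t *\<^sub>R b) *\<^sub>R (y - x)
        = (1 - t) *\<^sub>R (x + a *\<^sub>R (y - x)) + t *\<^sub>R (x + b *\<^sub>R (y - x))"
      by (simp add: algebra_simps)
    then show "g ((1 - t) *\<^sub>R a + t *\<^sub>R b) \<le> (1 - t) * g a + t * g b"
      unfolding g_def using convex_onD[OF assms(2), of t] \<open>0 < t\<close> \<open>t < 1\<close> by simp
  qed auto
  moreover have "(g has_real_derivative inner (gradient f x) (y - x)) (at 0)"
    using DERIV_along_line[OF assms(1), of x "y - x" 0] by (simp add: g_def[abs_def])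
  ultimately have "g 1 - g 0 \<ge> inner (gradient f x) (y - x) * (1 - 0)"
    by (intro convex_on_imp_above_tangent[of UNIV]) auto
  then show ?thesis by (simp add: g_def)
qed

text \<open>
  Subtracting the claimed upper bound from \<open>f\<close> along the segment from \<open>x\<close> to \<open>x + h\<close> leaves a function
  of \<open>t\<close> whose derivative is nonpositive: the gradient enters only through its component in the block
  of \<open>h\<close>, and that component is Lipschitz in this direction.
\<close>

lemma block_descent:
  assumes f: "f differentiable_on UNIV" and h: "h \<in> block_space blk i"
    and lip: "\<And>y h. h \<in> block_space blk i \<Longrightarrow>
         norm (block blk i (gradient f (y + h)) - block blk i (gradient f y)) \<le> l * norm h"
  shows "f (x + h) \<le> f x + inner (gradient f x) h + l / 2 * (norm h)\<^sup>2"
proof -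
  define g where "g t = f (x + t *\<^sub>R h) - t * inner (gradient f x) h - l / 2 * (norm h)\<^sup>2 * t\<^sup>2"
    for t :: real
  have "g 1 \<le> g 0"
  proof (rule DERIV_nonpos_imp_nonincreasing[of 0 1 g])
    fix t :: real assume "0 \<le> t" "t \<le> 1"
    let ?D = "inner (gradient f (x + t *\<^sub>R h)) h - inner (gradient f x) h - l * (norm h)\<^sup>2 * t"
    have "(g has_real_derivative ?D) (at t)"
    proof -
      have "((\<lambda>t. t * inner (gradient f x) h) has_real_derivative inner (gradient f x) h) (at t)"
        "((\<lambda>t. l / 2 * (norm h)\<^sup>2 * t\<^sup>2) has_real_derivative l * (norm h)\<^sup>2 * t) (at t)"
        by (auto intro!: derivative_eq_intros)
      from DERIV_diff[OF DERIV_diff[OF DERIV_along_line[OF f, of x h t] this(1)] this(2)]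
      show ?thesis unfolding g_def .
    qed
    moreover have "?D \<le> 0"
    proof -
      have th: "t *\<^sub>R h \<in> block_space blk i" by (rule block_space_scale[OF h])
      have "inner (gradient f (x + t *\<^sub>R h)) h - inner (gradient f x) h
          = inner (block blk i (gradient f (x + t *\<^sub>R h)) - block blk i (gradient f x)) h"
        by (metis h inner_block_space inner_diff_left)
      also have "\<dots> \<le> norm (block blk i (gradient f (x + t *\<^sub>R h)) - block blk i (gradient f x)) * norm h"
        by (rule norm_cauchy_schwarz)
      also have "\<dots> \<le> l * norm (t *\<^sub>R h) * norm h"
        by (intro mult_right_mono lip th) auto
      finally show ?thesis using \<open>0 \<le> t\<close> by (simp add: power2_eq_square algebra_simps)
    qed
    ultimately show "\<exists>D. (g has_real_derivative D) (at t) \<and> D \<le> 0" by blast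
  qed auto
  then show ?thesis by (simp add: g_def)
qed

section \<open>Proximal steps\<close>

lemma closed_convex_fun_on_convexD:
  assumes "closed_convex_fun_on S \<phi>" "x \<in> S" "y \<in> S" "0 \<le> t" "t \<le> 1"
    "\<phi> x \<le> ereal a" "\<phi> y \<le> ereal b"
  shows "(1 - t) *\<^sub>R x + t *\<^sub>R y \<in> S" "\<phi> ((1 - t) *\<^sub>R x + t *\<^sub>R y) \<le> ereal ((1 - t) * a + t * b)"
proof -
  have "convex {(x, t::real). x \<in> S \<and> \<phi> x \<le> ereal t}"
    using assms(1) by (simp add: closed_convex_fun_on_def)
  from convexD_alt[OF this, of "(x, a)" "(y, b)" t] assms(2-)
  show "(1 - t) *\<^sub>R x + t *\<^sub>R y \<in> S" "\<phi> ((1 - t) *\<^sub>R x + t *\<^sub>R y) \<le> ereal ((1 - t) * a + t * b)"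
    by auto
qed

text \<open>
  A closed epigraph makes the sublevel sets of \<open>q + \<phi>\<close> on \<open>K\<close> compact, because they are preimages of
  the epigraph under \<open>z \<mapsto> (z, t - q z)\<close>. Those for levels above the infimum are nonempty and nested, so
  they have a common point.
\<close>

lemma attains_min_on_compact:
  fixes \<phi> :: "'a::euclidean_space \<Rightarrow> ereal"
  assumes \<phi>: "closed_convex_fun_on S \<phi>" and q: "continuous_on UNIV q"
    and K: "compact K" and z0: "z0 \<in> S \<inter> K"
  shows "\<exists>z\<in>S \<inter> K. \<forall>y\<in>S \<inter> K. ereal (q z) + \<phi> z \<le> ereal (q y) + \<phi> y"
proof -
  define h where "h z = ereal (q z) + \<phi> z" for z
  have h_le: "h z \<le> ereal t \<longleftrightarrow> \<phi> z \<le> ereal (t - q z)" for z t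
    by (cases "\<phi> z") (auto simp: h_def)
  define m where "m = Inf (h ` (S \<inter> K))"
  define lev where "lev t = {z \<in> S \<inter> K. h z \<le> ereal t}" for t
  have comp: "compact (lev t)" for t
  proof -
    have "closed {(x, t::real). x \<in> S \<and> \<phi> x \<le> ereal t}"
      using \<phi> by (simp add: closed_convex_fun_on_def)
    moreover have "continuous_on UNIV (\<lambda>z. (z, t - q z))"
      using q by (intro continuous_intros)
    ultimately have "closed ((\<lambda>z. (z, t - q z)) -` {(x, t::real). x \<in> S \<and> \<phi> x \<le> ereal t})"
      using closed_vimage by blast
    then have "compact (K \<inter> ((\<lambda>z. (z, t - q z)) -` {(x, t::real). x \<in> S \<and> \<phi> x \<le> ereal t}))"
      by (rule compact_Int_closed[OF K])
    also have "K \<inter> ((\<lambda>z. (z, t - q z)) -` {(x, t::real). x \<in> S \<and> \<phi> x \<le> ereal t}) = lev t"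
      by (auto simp: lev_def h_le)
    finally show ?thesis .
  qed
  show ?thesis
  proof (cases "m = \<infinity>")
    case True
    have "h z \<le> h y" if "y \<in> S \<inter> K" for z y
      using True that Inf_lower[of "h y" "h ` (S \<inter> K)"] unfolding m_def by auto
    then show ?thesis using z0 by (auto simp: h_def)
  next
    case False
    define T where "T = {t::real. m < ereal t}"
    have "T \<noteq> {}"
      using False unfolding T_def by (cases m) (auto intro: exI[of _ "_ + 1"] lt_ex gt_ex)
    have ne: "lev t \<noteq> {}" if "t \<in> T" for t
      using that unfolding T_def m_def Inf_less_iff lev_def by force
    have "\<Inter>(lev ` T) \<noteq> {}"
    proof -
      obtain t0 where "t0 \<in> T" using \<open>T \<noteq> {}\<close> by blast
      have "lev t0 \<inter> \<Inter>(lev ` T) \<noteq> {}"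
      proof (rule compact_imp_fip_image[OF comp])
        fix I assume I: "finite I" "I \<subseteq> T"
        have fin: "finite (insert t0 I)" using I by simp
        have "Min (insert t0 I) \<in> T" using Min_in[OF fin] I \<open>t0 \<in> T\<close> by auto
        then obtain z where "z \<in> lev (Min (insert t0 I))" using ne by blast
        then have "h z \<le> ereal (Min (insert t0 I))" "z \<in> S \<inter> K" by (auto simp: lev_def)
        moreover have "ereal (Min (insert t0 I)) \<le> ereal t" if "t \<in> insert t0 I" for t
          using Min_le[OF fin that] by (simp del: Min_insert)
        ultimately have "z \<in> lev t" if "t \<in> insert t0 I" for t
          using that order_trans unfolding lev_def by blast
        then show "lev t0 \<inter> \<Inter>(lev ` I) \<noteq> {}" by auto
      qed (use comp compact_imp_closed in blast)
      then show ?thesis by blast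
    qed
    then obtain z where z: "\<And>t. t \<in> T \<Longrightarrow> z \<in> lev t" by blast
    have "z \<in> S \<inter> K" using z \<open>T \<noteq> {}\<close> unfolding lev_def by blast
    moreover have "h z \<le> m"
    proof (rule ccontr)
      assume "\<not> h z \<le> m"
      then obtain t where "m < ereal t" "ereal t < h z"
        by (metis ereal_dense2 not_le)
      then show False using z[of t] unfolding T_def lev_def by auto
    qed
    ultimately show ?thesis
      unfolding m_def h_def by (meson Inf_lower image_eqI order_trans)
  qed
qed

text \<open>
  On the unit ball around \<open>z0\<close> the function has a minimum \<open>m\<close>. If \<open>\<phi> z\<close> were too small at a
  distant \<open>z\<close>, convexity on the segment from \<open>z0\<close> to \<open>z\<close> would push the value below \<open>m\<close> where the
  segment leaves the ball.
\<close>

lemma closed_convex_linear_lower_bound: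
  fixes \<phi> :: "'a::euclidean_space \<Rightarrow> ereal"
  assumes \<phi>: "closed_convex_fun_on S \<phi>" and z0: "z0 \<in> S" "\<phi> z0 < \<infinity>"
  shows "\<exists>m a. 0 \<le> a \<and> (\<forall>z\<in>S. \<phi> z \<ge> ereal (m - a * norm (z - z0)))"
proof -
  have nminf: "\<phi> z \<noteq> -\<infinity>" if "z \<in> S" for z
    using \<phi> that by (auto simp: closed_convex_fun_on_def)
  obtain c where c: "\<phi> z0 = ereal c" using z0 nminf by (cases "\<phi> z0") auto
  obtain zm where zm: "zm \<in> S \<inter> cball z0 1"
    "\<And>y. y \<in> S \<inter> cball z0 1 \<Longrightarrow> \<phi> zm \<le> \<phi> y"
    using attains_min_on_compact[OF \<phi> continuous_on_const[of _ 0] compact_cball[of z0 1], of z0] z0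
    by auto
  have "\<phi> zm \<le> ereal c" using zm(2)[of z0] z0 c by simp
  then obtain m where m: "\<phi> zm = ereal m" "m \<le> c"
    using nminf zm(1) by (cases "\<phi> zm") auto
  have "\<phi> z \<ge> ereal (m - (c - m) * norm (z - z0))" if z: "z \<in> S" for z
  proof (cases "norm (z - z0) \<le> 1")
    case True
    then have "ereal m \<le> \<phi> z"
      using zm(2)[of z] z m by (simp add: dist_norm norm_minus_commute)
    moreover have "m - (c - m) * norm (z - z0) \<le> m" using m by simp
    ultimately show ?thesis by (meson ereal_less_eq(3) order_trans)
  next
    case False
    define r where "r = norm (z - z0)"
    have r: "r > 1" using False by (simp add: r_def)
    show ?thesis
    proof (cases "\<phi> z")
      case (real b)
      define w where "w = (1 - 1 / r) *\<^sub>R z0 + (1 / r) *\<^sub>R z"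
      have "w \<in> S" "\<phi> w \<le> ereal ((1 - 1 / r) * c + 1 / r * b)"
        unfolding w_def using closed_convex_fun_on_convexD[OF \<phi>, of z0 z "1 / r" c b] z z0 r c real
        by auto
      moreover have "w - z0 = (1 / r) *\<^sub>R (z - z0)" by (simp add: w_def algebra_simps)
      then have "norm (w - z0) = 1" using r by (auto simp: r_def)
      ultimately have "m \<le> (1 - 1 / r) * c + 1 / r * b"
        using zm(2)[of w] m by (simp add: dist_norm norm_minus_commute) (metis ereal_less_eq(3) order_trans)
      then have "r * m \<le> r * ((1 - 1 / r) * c + 1 / r * b)" using r by (intro mult_left_mono) auto
      also have "\<dots> = (r - 1) * c + b" using r by (simp add: field_simps)
      finally show ?thesis using real m by (simp add: r_def[symmetric] algebra_simps)
    qed (use nminf z in auto)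
  qed
  then show ?thesis using m by (intro exI[of _ m] exI[of _ "c - m"]) auto
qed

text \<open>
  The quadratic term dominates the linear lower bound of \<open>\<phi>\<close>, so every point outside a large ball
  has a larger value than \<open>z0\<close>, and the minimum over the ball is global.
\<close>

lemma prox_exists:
  fixes \<phi> :: "'a::euclidean_space \<Rightarrow> ereal" and g p :: 'a
  assumes \<phi>: "closed_convex_fun_on S \<phi>" and z0: "z0 \<in> S" "\<phi> z0 < \<infinity>" and l: "l > 0"
  defines "G \<equiv> \<lambda>z. ereal (inner g (z - p) + l / 2 * (norm (z - p))\<^sup>2) + \<phi> z"
  shows "\<exists>z\<in>S. \<forall>y\<in>S. G z \<le> G y"
proof -
  define q where "q z = inner g (z - p) + l / 2 * (norm (z - p))\<^sup>2" for z
  have nminf: "\<phi> z \<noteq> -\<infinity>" if "z \<in> S" for z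
    using \<phi> that by (auto simp: closed_convex_fun_on_def)
  obtain c where c: "\<phi> z0 = ereal c" using z0 nminf by (cases "\<phi> z0") auto
  obtain m a where ma: "0 \<le> a" "\<And>z. z \<in> S \<Longrightarrow> \<phi> z \<ge> ereal (m - a * norm (z - z0))"
    using closed_convex_linear_lower_bound[OF \<phi> z0] by blast
  \<comment> \<open>\<open>B\<close> bounds the slope of the linear terms, \<open>C\<close> collects the constants, and outside
  radius \<open>R\<close> the quadratic term exceeds \<open>B r + C\<close>.\<close>
  define B where "B = norm g + a"
  define C where "C = q z0 + c - m + a * norm (p - z0)"
  define R where "R = norm (z0 - p) + (2 * B + 2 * \<bar>C\<bar>) / l + 1"
  have qc: "continuous_on UNIV q" unfolding q_def by (intro continuous_intros)
  have "B \<ge> 0" using ma by (simp add: B_def)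
  then have "(2 * B + 2 * \<bar>C\<bar>) / l \<ge> 0" using l by simp
  then have "z0 \<in> S \<inter> cball p R" using z0 by (simp add: R_def dist_norm norm_minus_commute)
  from attains_min_on_compact[OF \<phi> qc compact_cball this] obtain z where
    z: "z \<in> S \<inter> cball p R" "\<And>y. y \<in> S \<inter> cball p R \<Longrightarrow> G z \<le> G y"
    unfolding G_def q_def by blast
  have "G z \<le> G y" if y: "y \<in> S" for y
  proof (cases "y \<in> cball p R")
    case False
    define r where "r = norm (y - p)"
    have "r > R" using False unfolding r_def by (simp add: dist_norm norm_minus_commute)
    then have r: "r > (2 * B + 2 * \<bar>C\<bar>) / l + 1"
      unfolding R_def using norm_ge_zero[of "z0 - p"] by linarith
    then have r1: "r > 1" using \<open>(2 * B + 2 * \<bar>C\<bar>) / l \<ge> 0\<close> by linarith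
    have "l * r > 2 * B + 2 * \<bar>C\<bar>" using r l by (simp add: field_simps)
    then have "r * (l * r) \<ge> r * (2 * B + 2 * \<bar>C\<bar>)" using r1 by (intro mult_left_mono) auto
    moreover have "r * \<bar>C\<bar> \<ge> 1 * \<bar>C\<bar>" using r1 by (intro mult_right_mono) auto
    ultimately have quad: "l / 2 * r\<^sup>2 \<ge> B * r + C" by (simp add: power2_eq_square algebra_simps)
    have "\<bar>inner g (y - p)\<bar> \<le> norm g * r" unfolding r_def by (rule Cauchy_Schwarz_ineq2)
    moreover have "a * norm (y - z0) \<le> a * (r + norm (p - z0))"
      using ma(1) norm_triangle_ineq[of "y - p" "p - z0"] by (intro mult_left_mono) (auto simp: r_def)
    ultimately have "q z0 + c \<le> q y + (m - a * norm (y - z0))"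
      using quad unfolding q_def[of y] r_def[symmetric] by (simp add: B_def C_def algebra_simps)
    then have "G z0 \<le> ereal (q y) + ereal (m - a * norm (y - z0))"
      by (simp add: G_def c q_def)
    also have "\<dots> \<le> G y" unfolding G_def q_def[symmetric] using ma(2)[OF y] by (intro add_left_mono)
    finally show ?thesis using z(2)[OF \<open>z0 \<in> S \<inter> cball p R\<close>] by simp
  qed (use z y in auto)
  then show ?thesis using z by blast
qed

text \<open>
  Moving from the minimiser \<open>z\<close> a fraction \<open>t\<close> towards \<open>y\<close> changes the objective by at most
  \<open>t A + O(t\<^sup>2)\<close>, where convexity of \<open>\<phi>\<close> gives \<open>A\<close> as below. Minimality makes this nonnegative,
  so \<open>A \<ge> 0\<close> on letting \<open>t\<close> tend to 0, which is the subgradient inequality.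
\<close>

lemma prox_subgradient:
  fixes \<phi> :: "'a::euclidean_space \<Rightarrow> ereal"
  assumes \<phi>: "closed_convex_fun_on S \<phi>" and z: "z \<in> S" "\<phi> z = ereal c" and y: "y \<in> S"
    and min: "\<And>y. y \<in> S \<Longrightarrow>
      ereal (inner g (z - p) + l / 2 * (norm (z - p))\<^sup>2) + \<phi> z
        \<le> ereal (inner g (y - p) + l / 2 * (norm (y - p))\<^sup>2) + \<phi> y"
  shows "\<phi> y \<ge> ereal (c + inner (- g - l *\<^sub>R (z - p)) (y - z))"
proof (cases "\<phi> y")
  case (real b)
  define v where "v = y - z"
  define A where "A = inner g v + l * inner (z - p) v + b - c"
  have ineq: "0 \<le> A + t * (l / 2 * (norm v)\<^sup>2)" if t: "0 < t" "t \<le> 1" for t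
  proof -
    define w where "w = (1 - t) *\<^sub>R z + t *\<^sub>R y"
    have w: "w \<in> S" "\<phi> w \<le> ereal ((1 - t) * c + t * b)"
      unfolding w_def using closed_convex_fun_on_convexD[OF \<phi>, of z y t c b] z y real t by auto
    have wp: "w - p = (z - p) + t *\<^sub>R v" by (simp add: w_def v_def algebra_simps)
    have "ereal (inner g (z - p) + l / 2 * (norm (z - p))\<^sup>2) + ereal c
      \<le> ereal (inner g (w - p) + l / 2 * (norm (w - p))\<^sup>2) + ereal ((1 - t) * c + t * b)"
      using order_trans[OF min[OF w(1)] add_left_mono[OF w(2)]] unfolding z(2) .
    then have le: "inner g (z - p) + l / 2 * (norm (z - p))\<^sup>2 + c
      \<le> inner g (w - p) + l / 2 * (norm (w - p))\<^sup>2 + ((1 - t) * c + t * b)"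
      by (simp only: plus_ereal.simps ereal_less_eq)
    have sq: "(norm (u + t *\<^sub>R v))\<^sup>2 = (norm u)\<^sup>2 + 2 * t * inner u v + t * (t * (norm v)\<^sup>2)" for u
      unfolding power2_norm_eq_inner by (simp add: inner_add_left inner_add_right inner_commute)
    have lin: "inner g (w - p) = inner g (z - p) + t * inner g v"
      unfolding wp by (simp only: inner_add_right inner_scaleR_right)
    have "t * (A + t * (l / 2 * (norm v)\<^sup>2)) = t * inner g v
        + l / 2 * (2 * t * inner (z - p) v + t * (t * (norm v)\<^sup>2)) + t * b - t * c"
      unfolding A_def by (simp only: ring_distribs) simp
    moreover have "l / 2 * (norm (w - p))\<^sup>2 = l / 2 * (norm (z - p))\<^sup>2
        + l / 2 * (2 * t * inner (z - p) v + t * (t * (norm v)\<^sup>2))"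
      unfolding wp sq by (simp only: ring_distribs add.assoc)
    moreover have "(1 - t) * c = c - t * c" by (simp only: left_diff_distrib mult_1)
    ultimately have "0 \<le> t * (A + t * (l / 2 * (norm v)\<^sup>2))"
      using le lin by linarith
    then show ?thesis using t by (simp add: zero_le_mult_iff)
  qed
  have "0 \<le> A"
  proof (rule tendsto_lowerbound)
    show "((\<lambda>t. A + t * (l / 2 * (norm v)\<^sup>2)) \<longlongrightarrow> A) (at_right 0)"
      by (auto intro!: tendsto_eq_intros)
    show "eventually (\<lambda>t. 0 \<le> A + t * (l / 2 * (norm v)\<^sup>2)) (at_right 0)"
      using ineq by (intro eventually_at_rightI[of 0 1]) auto
  qed simp
  moreover have "inner (- g - l *\<^sub>R (z - p)) v = - inner g v - l * inner (z - p) v"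
    by (simp only: inner_diff_left[of "- g"] inner_minus_left inner_scaleR_left)
  ultimately have "c + inner (- g - l *\<^sub>R (z - p)) v \<le> b" unfolding A_def by linarith
  then show ?thesis unfolding real v_def by (simp only: ereal_less_eq)
next
  case PInf
  then show ?thesis by simp
next
  case MInf
  moreover have "\<phi> y \<noteq> -\<infinity>" using \<phi> y unfolding closed_convex_fun_on_def by blast
  ultimately show ?thesis by blast
qed

section \<open>Expectations over the random indices\<close>

text \<open>
  A function of finitely many indices from a finite set takes finitely many values, and
  any \<open>Z\<close> is measurable because the vector of these indices lives in a discrete space.
\<close>

lemma (in prob_space) integrable_finite_dependence:
  fixes Z :: "(nat \<Rightarrow> 'n::finite) \<Rightarrow> real"
  assumes meas: "\<And>j. idx j \<in> measurable M (count_space UNIV)"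
    and dep: "\<And>\<sigma> \<tau>. (\<And>j. j < k \<Longrightarrow> \<sigma> j = \<tau> j) \<Longrightarrow> Z \<sigma> = Z \<tau>"
  shows "integrable M (\<lambda>\<omega>. Z (\<lambda>j. idx j \<omega>))"
proof -
  let ?W = "\<lambda>\<omega>. restrict (\<lambda>j. idx j \<omega>) {..<k}"
  let ?P = "PiE {..<k} (\<lambda>_. UNIV :: 'n set)"
  have W: "?W \<in> measurable M (count_space ?P)"
    using measurable_restrict[of "{..<k}" idx M "\<lambda>_. count_space UNIV"] meas
    by (simp add: count_space_PiM_finite)
  have eq: "(\<lambda>\<omega>. Z (\<lambda>j. idx j \<omega>)) = (\<lambda>\<omega>. Z (?W \<omega>))"
    by (rule ext, rule dep) simp
  have "integrable M (\<lambda>\<omega>. Z (?W \<omega>))"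
  proof (rule integrable_const_bound)
    show "(\<lambda>\<omega>. Z (?W \<omega>)) \<in> borel_measurable M"
      by (rule measurable_compose[OF W]) simp
    have fin: "finite ((\<lambda>\<tau>. \<bar>Z \<tau>\<bar>) ` ?P)" by (intro finite_imageI finite_PiE) auto
    have "\<bar>Z (?W \<omega>)\<bar> \<le> Max ((\<lambda>\<tau>. \<bar>Z \<tau>\<bar>) ` ?P)" for \<omega>
      by (rule Max_ge[OF fin]) auto
    then show "AE \<omega> in M. norm (Z (?W \<omega>)) \<le> Max ((\<lambda>\<tau>. \<bar>Z \<tau>\<bar>) ` ?P)" by simp
  qed
  then show ?thesis unfolding eq .
qed

text \<open>
  Splitting according to the value \<open>i\<close> of the last index, the indicator of that value is independent
  of \<open>Z\<close> with the last index overwritten by \<open>i\<close>, which depends on the earlier indices only.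
\<close>

lemma (in prob_space) expectation_average_last_index:
  fixes Z :: "(nat \<Rightarrow> 'n::finite) \<Rightarrow> real"
  assumes indep: "indep_vars (\<lambda>_. count_space UNIV) idx UNIV"
    and unif: "distr M (count_space UNIV) (idx k) = uniform_count_measure UNIV"
    and dep: "\<And>\<sigma> \<tau>. (\<And>j. j < Suc k \<Longrightarrow> \<sigma> j = \<tau> j) \<Longrightarrow> Z \<sigma> = Z \<tau>"
  shows "expectation (\<lambda>\<omega>. Z (\<lambda>j. idx j \<omega>))
    = expectation (\<lambda>\<omega>. (\<Sum>i\<in>UNIV. Z ((\<lambda>j. idx j \<omega>)(k := i))) / real CARD('n))"
proof -
  have meas: "idx j \<in> measurable M (count_space UNIV)" for j
    using indep by (simp add: indep_vars_def)
  let ?Z = "\<lambda>i \<omega>. Z ((\<lambda>j. idx j \<omega>)(k := i))"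
  let ?I = "\<lambda>i \<omega>. indicator {i} (idx k \<omega>) :: real"
  have intZ: "integrable M (?Z i)" for i
    by (rule integrable_finite_dependence[OF meas, of k "\<lambda>\<tau>. Z (\<tau>(k := i))"]) (auto intro!: dep)
  have intI: "integrable M (?I i)" for i
    by (rule integrable_finite_dependence[OF meas, of "Suc k" "\<lambda>\<tau>. indicator {i} (\<tau> k)"]) auto
  have indZI: "indep_var borel (?Z i) borel (?I i)" for i
  proof -
    let ?Y1 = "\<lambda>\<tau>. Z (\<tau>(k := i))" and ?Y2 = "\<lambda>\<tau>. indicator {i} (\<tau> k) :: real"
    have "indep_var borel (?Y1 \<circ> (\<lambda>\<omega>. restrict (\<lambda>j. idx j \<omega>) {..<k}))
       borel (?Y2 \<circ> (\<lambda>\<omega>. restrict (\<lambda>j. idx j \<omega>) {k}))"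
      by (rule indep_var_compose[OF indep_var_restrict[OF indep]])
        (auto simp: count_space_PiM_finite)
    moreover have "?Y1 \<circ> (\<lambda>\<omega>. restrict (\<lambda>j. idx j \<omega>) {..<k}) = ?Z i"
      by (rule ext) (auto intro!: dep)
    moreover have "?Y2 \<circ> (\<lambda>\<omega>. restrict (\<lambda>j. idx j \<omega>) {k}) = ?I i" by auto
    ultimately show ?thesis by simp
  qed
  have expI: "expectation (?I i) = 1 / real CARD('n)" for i
  proof -
    have "expectation (?I i) = (\<integral>y. indicator {i} y \<partial>distr M (count_space UNIV) (idx k))"
      by (rule integral_distr[OF meas, symmetric]) simp
    also have "\<dots> = measure (uniform_count_measure UNIV) {i}" unfolding unif by simp
    finally show ?thesis by (simp add: measure_uniform_count_measure)
  qed
  have split: "(\<lambda>\<omega>. Z (\<lambda>j. idx j \<omega>)) = (\<lambda>\<omega>. \<Sum>i\<in>UNIV. ?Z i \<omega> * ?I i \<omega>)"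
  proof
    fix \<omega>
    have "(\<Sum>i\<in>UNIV. ?Z i \<omega> * ?I i \<omega>) = (\<Sum>i\<in>UNIV. if i = idx k \<omega> then ?Z i \<omega> else 0)"
      by (rule sum.cong) (auto simp: indicator_def)
    then show "Z (\<lambda>j. idx j \<omega>) = (\<Sum>i\<in>UNIV. ?Z i \<omega> * ?I i \<omega>)" by (simp add: fun_upd_idem)
  qed
  have "expectation (\<lambda>\<omega>. Z (\<lambda>j. idx j \<omega>)) = (\<Sum>i\<in>UNIV. expectation (\<lambda>\<omega>. ?Z i \<omega> * ?I i \<omega>))"
    unfolding split by (intro Bochner_Integration.integral_sum indep_var_integrable[OF indZI intZ intI])
  also have "\<dots> = (\<Sum>i\<in>UNIV. expectation (?Z i) * (1 / real CARD('n)))"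
    by (simp only: indep_var_lebesgue_integral[OF indZI intZ intI] expI)
  also have "\<dots> = expectation (\<lambda>\<omega>. (\<Sum>i\<in>UNIV. ?Z i \<omega>) / real CARD('n))"
    by (simp add: intZ sum_divide_distrib)
  finally show ?thesis .
qed

lemma ereal_expectation_real:
  assumes "integrable M X"
  shows "ereal_expectation M (\<lambda>\<omega>. ereal (X \<omega>)) = ereal (\<integral>\<omega>. X \<omega> \<partial>M)"
proof -
  have fin: "(\<integral>\<^sup>+ \<omega>. ennreal (X \<omega>) \<partial>M) < \<infinity>" "(\<integral>\<^sup>+ \<omega>. ennreal (- X \<omega>) \<partial>M) < \<infinity>"
    using integrableD[OF assms] by (auto simp: less_top)
  have "enn2ereal a - enn2ereal b = ereal (enn2real a - enn2real b)" if "a < \<infinity>" "b < \<infinity>" for a b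
    using that by (cases a; cases b) auto
  from this[OF fin] show ?thesis
    by (simp add: ereal_expectation_def real_lebesgue_integral_def[OF assms] e2ennreal_ereal)
qed

text \<open>
  Lets a bound that holds for every distance to a minimiser pass to the infimum of the distances:
  the set of admissible \<open>r\<close> is closed.
\<close>

lemma le_at_Inf_of_squares:
  fixes S :: "real set"
  assumes "S \<noteq> {}" "bdd_below S" and "\<And>r. r \<in> S \<Longrightarrow> a \<le> c * (b * r\<^sup>2 + e)"
  shows "a \<le> c * (b * (Inf S)\<^sup>2 + e)"
proof -
  have "closed {r. a \<le> c * (b * r\<^sup>2 + e)}"
    by (intro closed_Collect_le continuous_intros)
  then have "closure S \<subseteq> {r. a \<le> c * (b * r\<^sup>2 + e)}"
    using assms(3) by (intro closure_minimal) auto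
  then show ?thesis using closure_contains_Inf[OF assms(1,2)] by auto
qed

section \<open>The composite problem and its block steps\<close>

locale composite_problem =
  fixes blk :: "'m::finite \<Rightarrow> 'n::finite"
    and L :: "'n \<Rightarrow> real"
    and f :: "real ^ 'm \<Rightarrow> real"
    and \<psi> :: "'n \<Rightarrow> real ^ 'm \<Rightarrow> ereal"
  assumes f_convex: "convex_on UNIV f"
    and f_diff: "f differentiable_on UNIV"
    and L_pos: "\<And>i. L i > 0"
    and f_lipschitz:
      "\<And>y i h. h \<in> block_space blk i \<Longrightarrow>
         norm (block blk i (gradient f (y + h)) - block blk i (gradient f y)) \<le> L i * norm h"
    and psi_closed_convex: "\<And>i. closed_convex_fun_on (block_space blk i) (\<psi> i)"
    and opt_finite: "\<bar>opt_value (objective blk f \<psi>)\<bar> \<noteq> \<infinity>"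
    and solutions_nonempty: "opt_solutions (objective blk f \<psi>) \<noteq> {}"
begin

abbreviation "F \<equiv> objective blk f \<psi>"
abbreviation "\<Psi> \<equiv> block_sum blk \<psi>"
abbreviation "step \<equiv> block_step blk L f \<psi>"
abbreviation "ipL \<equiv> inner_L blk L"
abbreviation "sqL x \<equiv> inner_L blk L x x"

text \<open>
  The domain of the objective. On it every summand is finite, and the computations use the
  real-valued versions of \<open>\<psi>\<close>, \<open>\<Psi>\<close> and \<open>F\<close> defined next; off it \<open>F\<close> is infinite.
\<close>

definition feasible :: "(real ^ 'm) set" where
  "feasible = {y. \<forall>i. \<psi> i (block blk i y) < \<infinity>}"

definition psi_real :: "'n \<Rightarrow> real ^ 'm \<Rightarrow> real" where
  "psi_real i y = real_of_ereal (\<psi> i (block blk i y))"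

definition Psi_real :: "real ^ 'm \<Rightarrow> real" where
  "Psi_real y = (\<Sum>i\<in>UNIV. psi_real i y)"

definition F_real :: "real ^ 'm \<Rightarrow> real" where
  "F_real y = f y + Psi_real y"

definition opt_real :: real where
  "opt_real = real_of_ereal (opt_value F)"

definition full_step :: "real ^ 'm \<Rightarrow> real ^ 'm" where
  "full_step x = (\<Sum>i\<in>UNIV. step i x)"

text \<open>
  The minimal value, attained at \<^term>\<open>full_step x\<close>, of the separable model that linearises \<open>f\<close> at \<open>x\<close>
  and adds half the squared \<open>L\<close>-norm of the displacement and \<open>\<Psi>\<close>.
\<close>

definition model_value :: "real ^ 'm \<Rightarrow> real" where
  "model_value x = f x + inner (gradient f x) (full_step x) + 1 / 2 * sqL (full_step x)
     + Psi_real (x + full_step x)"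

lemma psi_not_MInf: "\<psi> i (block blk i y) \<noteq> -\<infinity>"
  using psi_closed_convex[of i] by (simp add: closed_convex_fun_on_def)

lemma psi_eq_real: "y \<in> feasible \<Longrightarrow> \<psi> i (block blk i y) = ereal (psi_real i y)"
  using psi_not_MInf[of i y] unfolding feasible_def psi_real_def
  by (cases "\<psi> i (block blk i y)") (auto dest: spec[of _ i])

lemma Psi_eq_real: "y \<in> feasible \<Longrightarrow> \<Psi> y = ereal (Psi_real y)"
  by (simp add: block_sum_def Psi_real_def psi_eq_real)

lemma F_eq_real: "y \<in> feasible \<Longrightarrow> F y = ereal (F_real y)"
  by (simp add: objective_def F_real_def Psi_eq_real)

lemma Psi_infinite: "y \<notin> feasible \<Longrightarrow> \<Psi> y = \<infinity>"
  unfolding block_sum_def feasible_def sum_Pinfty by auto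

lemma F_infinite: "y \<notin> feasible \<Longrightarrow> F y = \<infinity>"
  by (simp add: objective_def Psi_infinite)

lemma edom_Psi: "edom \<Psi> = feasible"
  using Psi_eq_real Psi_infinite by (force simp: edom_def)

lemma opt_value_eq: "opt_value F = ereal opt_real"
  using opt_finite by (simp add: opt_real_def ereal_real)

lemma opt_solution_feasible:
  assumes "xs \<in> opt_solutions F" shows "xs \<in> feasible" "F_real xs = opt_real"
proof -
  have "F xs = ereal opt_real" using assms by (simp add: opt_solutions_def opt_value_eq)
  then show "xs \<in> feasible" "F_real xs = opt_real" using F_infinite[of xs] F_eq_real[of xs] by force+
qed

lemma opt_real_le: "y \<in> feasible \<Longrightarrow> opt_real \<le> F_real y"
  by (metis F_eq_real Inf_lower UNIV_I ereal_less_eq(3) imageI opt_value_def opt_value_eq)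

text \<open>
  The step is defined by a choice, so a minimiser has to be exhibited first. The change of variable
  \<open>z = x\<^sub>i + d\<close> turns the subproblem into a proximal problem for \<open>\<psi> i\<close>, which is proper because
  a minimiser of \<open>F\<close> is feasible; comparing with that minimiser also makes the value after the step
  finite, even when \<open>x\<close> itself is not feasible.
\<close>

lemma step_arg_min:
  defines "G \<equiv> \<lambda>i x d. ereal (inner (block blk i (gradient f x)) d + L i / 2 * (norm d)\<^sup>2)
             + \<psi> i (block blk i x + d)"
  shows step_in_block_space: "step i x \<in> block_space blk i"
    and step_minimal: "\<And>d. d \<in> block_space blk i \<Longrightarrow> G i x (step i x) \<le> G i x d"
    and step_finite: "\<psi> i (block blk i x + step i x) < \<infinity>"
proof -
  obtain xs where xs: "xs \<in> feasible" using solutions_nonempty opt_solution_feasible(1) by blast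
  let ?S = "block_space blk i" and ?p = "block blk i x" and ?g = "block blk i (gradient f x)"
  obtain z where z: "z \<in> ?S"
    "\<And>y. y \<in> ?S \<Longrightarrow> ereal (inner ?g (z - ?p) + L i / 2 * (norm (z - ?p))\<^sup>2) + \<psi> i z
      \<le> ereal (inner ?g (y - ?p) + L i / 2 * (norm (y - ?p))\<^sup>2) + \<psi> i y"
    using prox_exists[OF psi_closed_convex[of i] block_in_block_space[of blk i xs] _ L_pos[of i], of ?g ?p] xs
    unfolding feasible_def by auto
  have "is_arg_min (G i x) (\<lambda>d. d \<in> ?S) (z - ?p)"
    unfolding is_arg_min_def
  proof (intro conjI notI)
    show "z - ?p \<in> ?S" by (rule block_space_diff[OF z(1) block_in_block_space])
    assume "\<exists>d. d \<in> ?S \<and> G i x d < G i x (z - ?p)"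
    then obtain d where "d \<in> ?S" "G i x d < G i x (z - ?p)" by blast
    moreover have "?p + d \<in> ?S" by (rule block_space_add[OF block_in_block_space \<open>d \<in> ?S\<close>])
    ultimately show False using z(2)[of "?p + d"] unfolding G_def by simp
  qed
  moreover have "step i x = arg_min (G i x) (\<lambda>d. d \<in> ?S)"
    unfolding block_step_def arg_min_on_def G_def ..
  ultimately have am: "is_arg_min (G i x) (\<lambda>d. d \<in> ?S) (step i x)"
    unfolding arg_min_def by (metis someI)
  show "step i x \<in> ?S" using am by (simp add: is_arg_min_def)
  show min: "G i x (step i x) \<le> G i x d" if "d \<in> ?S" for d
    using am that by (meson is_arg_min_def not_le)
  have "block blk i xs - ?p \<in> ?S" by (intro block_space_diff block_in_block_space)
  from min[OF this] have "G i x (step i x) \<le> G i x (block blk i xs - ?p)" .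
  also have "G i x (block blk i xs - ?p) < \<infinity>" using xs by (simp add: G_def psi_eq_real)
  finally show "\<psi> i (block blk i x + step i x) < \<infinity>" by (auto simp: G_def)
qed

lemma block_full_step: "block blk i (full_step x) = step i x"
  unfolding full_step_def by (rule block_sum_vectors) (rule step_in_block_space)

lemma block_step_same: "block blk i (x + step i x) = block blk i x + step i x"
  by (simp add: block_add step_in_block_space)

lemma block_step_other: "j \<noteq> i \<Longrightarrow> block blk j (x + step i x) = block blk j x"
  by (simp add: block_add block_of_other_block_space[OF step_in_block_space])

lemma block_after_full_step: "block blk i (x + full_step x) = block blk i x + step i x"
  by (simp add: block_add block_full_step)

lemma full_step_feasible: "x + full_step x \<in> feasible"
  using step_finite by (simp add: feasible_def block_after_full_step)

lemma psi_after_step: "\<psi> i (block blk i x + step i x) = ereal (psi_real i (x + full_step x))"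
  using psi_eq_real[OF full_step_feasible] by (metis block_after_full_step)

lemma step_feasible: "x \<in> feasible \<Longrightarrow> x + step i x \<in> feasible"
  unfolding feasible_def
proof (clarify)
  fix j assume "\<forall>i. \<psi> i (block blk i x) < \<infinity>"
  then show "\<psi> j (block blk j (x + step i x)) < \<infinity>"
    by (cases "j = i") (use step_finite in \<open>auto simp: block_step_same block_step_other\<close>)
qed

lemma sqL_step: "sqL (step i x) = L i * (norm (step i x))\<^sup>2"
  using inner_L_block_space[OF step_in_block_space]
  by (simp add: step_in_block_space power2_norm_eq_inner)

lemma inner_L_full_step: "ipL y (full_step x) = (\<Sum>i\<in>UNIV. ipL y (step i x))"
  by (simp add: inner_L_block_space[OF step_in_block_space] inner_L_def[of _ _ _ "full_step x"]
      block_full_step)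

lemma sqL_full_step: "sqL (full_step x) = (\<Sum>i\<in>UNIV. sqL (step i x))"
  by (simp add: inner_L_full_step inner_L_block_space[OF step_in_block_space] block_full_step
      step_in_block_space)

text \<open>
  The subgradient inequalities of the separate proximal problems add up, since \<open>\<Psi>\<close> and the inner
  product are both sums over the blocks. Having a subgradient at exactly this point is what makes the
  strong convexity of \<open>\<Psi>\<close> applicable, as that is stated through subgradients.
\<close>

lemma subgradient_after_full_step:
  "- gradient f x - (\<Sum>i\<in>UNIV. L i *\<^sub>R step i x) \<in> subdifferential \<Psi> (x + full_step x)"
  unfolding subdifferential_def
proof (clarify)
  fix y
  let ?w = "x + full_step x" and ?s = "- gradient f x - (\<Sum>i\<in>UNIV. L i *\<^sub>R step i x)"
  have bs: "block blk i ?s = - block blk i (gradient f x) - L i *\<^sub>R step i x" for i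
  proof -
    have "block blk i (\<Sum>i\<in>UNIV. L i *\<^sub>R step i x) = L i *\<^sub>R step i x"
      by (rule block_sum_vectors) (intro block_space_scale step_in_block_space)
    then show ?thesis by (simp add: block_diff linear_neg[OF linear_block])
  qed
  have "ereal (psi_real i ?w + inner (block blk i ?s) (block blk i (y - ?w))) \<le> \<psi> i (block blk i y)"
    for i
  proof -
    have "block blk i x + step i x \<in> block_space blk i" by (intro block_space_add block_in_block_space step_in_block_space)
    have "ereal (psi_real i ?w + inner (- block blk i (gradient f x) - L i *\<^sub>R step i x)
      (block blk i y - (block blk i x + step i x))) \<le> \<psi> i (block blk i y)"
    proof -
      let ?p = "block blk i x" and ?g = "block blk i (gradient f x)"
      have "ereal (inner ?g (?p + step i x - ?p) + L i / 2 * (norm (?p + step i x - ?p))\<^sup>2)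
          + \<psi> i (?p + step i x)
        \<le> ereal (inner ?g (z - ?p) + L i / 2 * (norm (z - ?p))\<^sup>2) + \<psi> i z"
        if "z \<in> block_space blk i" for z
        using step_minimal[OF block_space_diff[OF that block_in_block_space[of blk i x]], of x] by simp
      from prox_subgradient[OF psi_closed_convex \<open>?p + step i x \<in> _\<close> psi_after_step
          block_in_block_space this]
      show ?thesis by simp
    qed
    then show ?thesis unfolding bs by (simp add: block_diff block_after_full_step)
  qed
  then have "(\<Sum>i\<in>UNIV. ereal (psi_real i ?w + inner (block blk i ?s) (block blk i (y - ?w)))) \<le> \<Psi> y"
    unfolding block_sum_def by (intro sum_mono)
  then show "\<Psi> ?w + ereal (inner ?s (y - ?w)) \<le> \<Psi> y"
    by (simp only: sum_ereal sum.distrib Psi_eq_real[OF full_step_feasible] Psi_real_def plus_ereal.simps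
        inner_sum_blocks[of ?s "y - ?w" blk])
qed

section \<open>Progress of one random step\<close>

lemma f_strong_convexity:
  assumes "strong_convexity_ineq blk L (\<lambda>y. ereal (f y)) \<mu>"
  shows "f y \<ge> f x + inner (gradient f x) (y - x) + \<mu> / 2 * sqL (y - x)"
proof -
  have "gradient f x \<in> subdifferential (\<lambda>y. ereal (f y)) x"
    using convex_above_gradient[OF f_diff f_convex] by (simp add: subdifferential_def)
  then have "ereal (f y) \<ge> ereal (f x) + ereal (inner (gradient f x) (y - x))
      + ereal (\<mu> / 2 * (norm_L blk L (y - x))\<^sup>2)"
    using assms unfolding strong_convexity_ineq_def edom_def by auto
  then show ?thesis by (simp add: norm_L_sq[of L, OF L_pos])
qed

text \<open>
  Strong convexity of \<open>f\<close> at \<open>x\<close> and of \<open>\<Psi>\<close> at \<open>x + full_step x\<close> are added; the gradient terms of the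
  subgradient cancel those of \<open>f\<close>, and what is left is expressed in the \<open>L\<close>-inner product.
\<close>

lemma model_lower_bound:
  assumes f: "strong_convexity_ineq blk L (\<lambda>y. ereal (f y)) \<mu>f"
    and p: "strong_convexity_ineq blk L \<Psi> \<mu>\<psi>" and y: "y \<in> feasible"
  shows "F_real y \<ge> model_value x + 1 / 2 * sqL (full_step x) - ipL (full_step x) (y - x)
     + \<mu>f / 2 * sqL (y - x) + \<mu>\<psi> / 2 * sqL (y - (x + full_step x))"
proof -
  let ?d = "full_step x" and ?g = "gradient f x"
  let ?w = "x + ?d" and ?s = "- gradient f x - (\<Sum>i\<in>UNIV. L i *\<^sub>R step i x)"
  have "\<Psi> y \<ge> \<Psi> ?w + ereal (inner ?s (y - ?w)) + ereal (\<mu>\<psi> / 2 * (norm_L blk L (y - ?w))\<^sup>2)"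
    using p[unfolded strong_convexity_ineq_def edom_Psi, THEN bspec, OF full_step_feasible,
        THEN bspec, OF y, THEN bspec, OF subgradient_after_full_step] .
  then have 1: "Psi_real y \<ge> Psi_real ?w + inner ?s (y - ?w) + \<mu>\<psi> / 2 * sqL (y - ?w)"
    unfolding Psi_eq_real[OF y] Psi_eq_real[OF full_step_feasible] by (simp add: norm_L_sq[of L, OF L_pos])
  have "inner (\<Sum>i\<in>UNIV. L i *\<^sub>R step i x) v = ipL ?d v" for v
  proof -
    have "inner (step i x) v = inner (step i x) (block blk i v)" for i
      using inner_block_space[OF step_in_block_space[of i x], of v] by (simp only: inner_commute)
    then show ?thesis by (simp add: inner_L_def block_full_step inner_sum_left)
  qed
  then have 2: "inner ?s (y - ?w) = - inner ?g (y - x) + inner ?g ?d - ipL ?d (y - x) + sqL ?d"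
    by (simp add: inner_diff_left inner_L_diff_right inner_L_add_right inner_diff_right
        inner_add_right)
  show ?thesis
    using 1 f_strong_convexity[OF f, of x y] unfolding 2 F_real_def model_value_def by linarith
qed

text \<open>
  An upper bound for the change of \<open>F\<close> caused by a step in block \<open>i\<close>. It evaluates \<open>\<psi> i\<close> at
  \<^term>\<open>x + full_step x\<close>, which has the same block \<open>i\<close> as \<^term>\<open>x + step i x\<close>, so that the sum over
  \<open>i\<close> is visibly \<^term>\<open>model_value x - F_real x\<close>.
\<close>

definition block_gain :: "'n \<Rightarrow> real ^ 'm \<Rightarrow> real" where
  "block_gain i x = inner (gradient f x) (step i x) + 1 / 2 * sqL (step i x)
     + psi_real i (x + full_step x) - psi_real i x"

lemma f_descent: "f (x + step i x) \<le> f x + inner (gradient f x) (step i x) + 1 / 2 * sqL (step i x)"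
  using block_descent[OF f_diff step_in_block_space f_lipschitz] by (simp add: sqL_step)

lemma F_after_step: "x \<in> feasible \<Longrightarrow> F_real (x + step i x) \<le> F_real x + block_gain i x"
proof -
  have "psi_real j (x + step i x) = (if j = i then psi_real i (x + full_step x) else psi_real j x)" for j
    by (simp add: psi_real_def block_step_same block_step_other block_after_full_step)
  then have "Psi_real (x + step i x)
      = (\<Sum>j\<in>UNIV. psi_real j x + (if j = i then psi_real i (x + full_step x) - psi_real i x else 0))"
    unfolding Psi_real_def by (intro sum.cong) auto
  also have "\<dots> = Psi_real x + psi_real i (x + full_step x) - psi_real i x"
    by (simp add: Psi_real_def sum.distrib)
  finally show ?thesis using f_descent[of x i] by (simp add: F_real_def block_gain_def)
qed

lemma block_gain_nonpos: "x \<in> feasible \<Longrightarrow> block_gain i x \<le> 0"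
  using step_minimal[OF block_space_0, of i x]
  by (simp add: psi_after_step psi_eq_real block_gain_def sqL_step
      inner_block_space[OF step_in_block_space, symmetric])

lemma F_step_le: "x \<in> feasible \<Longrightarrow> F_real (x + step i x) \<le> F_real x"
  using F_after_step block_gain_nonpos by (metis add.right_neutral add_left_mono order_trans)

lemma sum_block_gain: "(\<Sum>i\<in>UNIV. block_gain i x) = model_value x - F_real x"
proof -
  have "inner (gradient f x) (full_step x) = (\<Sum>i\<in>UNIV. inner (gradient f x) (step i x))"
    by (simp add: full_step_def inner_sum_right)
  then show ?thesis
    by (simp add: block_gain_def model_value_def F_real_def Psi_real_def sum.distrib sum_subtractf
        sqL_full_step sum_divide_distrib)
qed

lemma sum_F_after_step:
  assumes "x \<in> feasible"
  shows "(\<Sum>i\<in>UNIV. F_real (x + step i x)) \<le> (real CARD('n) - 1) * F_real x + model_value x"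
proof -
  have "(\<Sum>i\<in>UNIV. F_real (x + step i x)) \<le> (\<Sum>i\<in>UNIV. F_real x + block_gain i x)"
    by (intro sum_mono F_after_step assms)
  then show ?thesis by (simp add: sum.distrib sum_block_gain algebra_simps)
qed

lemma sum_sqL_after_step:
  "(\<Sum>i\<in>UNIV. sqL (v + step i x)) = real CARD('n) * sqL v + 2 * ipL v (full_step x) + sqL (full_step x)"
proof -
  have "sqL (v + step i x) = sqL v + 2 * ipL v (step i x) + sqL (step i x)" for i
    by (simp add: inner_L_add_left inner_L_add_right inner_L_commute)
  then show ?thesis
    by (simp add: sum.distrib inner_L_full_step[of v] sqL_full_step sum_distrib_left)
qed

lemma sqL_nonneg: "sqL v \<ge> 0"
  by (simp add: inner_L_def sum_nonneg L_pos less_imp_le)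

text \<open>
  The weight \<open>1 + \<mu>\<psi>\<close> is chosen to absorb the term of \<open>model_lower_bound\<close> in the distance from
  \<open>x + full_step x\<close> to \<open>xs\<close>: that distance after all block steps is determined by the current one and the average
  squared distance after one of them (\<open>sum_sqL_after_step\<close>).
\<close>

lemma potential_step:
  assumes f: "strong_convexity_ineq blk L (\<lambda>y. ereal (f y)) \<mu>f"
    and p: "strong_convexity_ineq blk L \<Psi> \<mu>\<psi>" and x: "x \<in> feasible" and xs: "xs \<in> opt_solutions F"
  defines "V \<equiv> \<lambda>y. (1 + \<mu>\<psi>) / 2 * sqL (y - xs) + (F_real y - opt_real)"
  shows "(\<Sum>i\<in>UNIV. V (x + step i x)) / real CARD('n)
    \<le> V x - ((\<mu>f + \<mu>\<psi>) / 2 * sqL (x - xs) + (F_real x - opt_real)) / real CARD('n)"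
proof -
  let ?n = "real CARD('n)" and ?d = "full_step x" and ?v = "x - xs"
  let ?D = "sqL ?d" and ?I = "ipL ?v ?d" and ?R = "sqL ?v"
  have neg: "sqL (xs - x) = ?R" "ipL ?d (xs - x) = - ?I" "sqL (xs - (x + ?d)) = ?R + 2 * ?I + ?D"
    by (simp_all add: inner_L_add_left inner_L_add_right inner_L_diff_left inner_L_diff_right inner_L_commute)
  have A: "opt_real \<ge> model_value x + 1 / 2 * ?D + ?I + \<mu>f / 2 * ?R + \<mu>\<psi> / 2 * (?R + 2 * ?I + ?D)"
    using model_lower_bound[OF f p opt_solution_feasible(1)[OF xs], of x]
    unfolding neg opt_solution_feasible(2)[OF xs] by simp
  have "(\<Sum>i\<in>UNIV. V (x + step i x))
      = (1 + \<mu>\<psi>) / 2 * (\<Sum>i\<in>UNIV. sqL (?v + step i x)) + (\<Sum>i\<in>UNIV. F_real (x + step i x)) - ?n * opt_real"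
    by (simp add: V_def sum.distrib sum_subtractf sum_distrib_left algebra_simps)
  also have "\<dots> \<le> (1 + \<mu>\<psi>) / 2 * (?n * ?R + 2 * ?I + ?D) + ((?n - 1) * F_real x + model_value x) - ?n * opt_real"
    using sum_F_after_step[OF x] by (simp add: sum_sqL_after_step)
  also have "\<dots> \<le> ?n * V x - ((\<mu>f + \<mu>\<psi>) / 2 * ?R + (F_real x - opt_real))"
    using A by (simp add: V_def field_simps)
  finally show ?thesis by (simp add: field_simps)
qed

text \<open>
  At a minimiser no block step can decrease \<open>F\<close>, so the model value is at least the optimal value;
  \<open>model_lower_bound\<close> with both points equal to the minimiser then forces the full step to be
  zero. With a zero step, \<open>model_lower_bound\<close> at the minimiser is the growth inequality.
\<close>

lemma quadratic_growth:
  assumes f: "strong_convexity_ineq blk L (\<lambda>y. ereal (f y)) \<mu>f"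
    and p: "strong_convexity_ineq blk L \<Psi> \<mu>\<psi>" and nn: "\<mu>\<psi> \<ge> 0"
    and xs: "xs \<in> opt_solutions F" and y: "y \<in> feasible"
  shows "F_real y - opt_real \<ge> (\<mu>f + \<mu>\<psi>) / 2 * sqL (y - xs)"
proof -
  let ?n = "real CARD('n)" and ?d = "full_step xs"
  note xd = opt_solution_feasible[OF xs]
  have "?n * opt_real = (\<Sum>i\<in>(UNIV::'n set). opt_real)" by simp
  also have "\<dots> \<le> (\<Sum>i\<in>UNIV. F_real (xs + step i xs))"
    by (intro sum_mono opt_real_le step_feasible xd)
  finally have H: "model_value xs \<ge> opt_real"
    using sum_F_after_step[OF xd(1)] xd(2) by (simp add: algebra_simps)
  have "\<mu>\<psi> / 2 * sqL (xs - (xs + ?d)) \<ge> 0"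
    using nn sqL_nonneg by simp
  then have "sqL ?d \<le> 0"
    using model_lower_bound[OF f p xd(1), of xs] H xd(2) by (simp add: inner_L_def block_0)
  have "L i * inner (step i xs) (step i xs) = 0" for i
    using \<open>sqL ?d \<le> 0\<close> sqL_nonneg[of ?d] L_pos
      sum_nonneg_eq_0_iff[of UNIV "\<lambda>i. L i * inner (block blk i ?d) (block blk i ?d)"]
    by (simp add: inner_L_def block_full_step less_imp_le)
  then have "step i xs = 0" for i using L_pos[of i] by (metis inner_eq_zero_iff less_irrefl mult_eq_0_iff)
  then have "?d = 0" by (simp add: full_step_def)
  then show ?thesis
    using model_lower_bound[OF f p y, of xs] H by (simp add: inner_L_def[of _ _ 0] block_0 algebra_simps add_divide_distrib)
qed

text \<open>
  Along a coordinate vector, strong convexity bounds \<open>f\<close> below by a parabola and the descent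
  lemma bounds it above by the parabola for the parameter 1.
\<close>

lemma convexity_parameter_f_le_1:
  assumes f: "strong_convexity_ineq blk L (\<lambda>y. ereal (f y)) \<mu>f"
  shows "\<mu>f \<le> 1"
proof -
  obtain j :: 'm where True by simp
  define i where "i = blk j"
  define h :: "real ^ 'm" where "h = axis j 1"
  have h: "h \<in> block_space blk i" by (auto simp: block_space_def h_def i_def axis_def)
  have nh: "norm h = 1" by (simp add: h_def norm_eq_sqrt_inner inner_axis_axis)
  have sq: "sqL h = L i" using inner_L_block_space[OF h, of L h] nh
    by (simp add: block_of_block_space[OF h] dot_square_norm)
  have "f (0 + h) \<le> f 0 + inner (gradient f 0) h + L i / 2 * (norm h)\<^sup>2"
    by (rule block_descent[OF f_diff h f_lipschitz])
  then have "\<mu>f / 2 * L i \<le> L i / 2"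
    using f_strong_convexity[OF f, of 0 h] sq nh by simp
  then show ?thesis using L_pos[of i] by (simp add: field_simps)
qed

text \<open>
  With one block and \<open>\<mu>\<^sub>f = 1\<close> the lower bounds of \<open>model_lower_bound\<close> complete a square, so they say that
  the model value is at most the optimal value. This covers starting points at which \<open>F\<close> is infinite.
\<close>

lemma single_block_exact_step:
  assumes f: "strong_convexity_ineq blk L (\<lambda>y. ereal (f y)) 1"
    and p: "strong_convexity_ineq blk L \<Psi> \<mu>\<psi>" and nn: "\<mu>\<psi> \<ge> 0" and n: "CARD('n) = 1"
  shows "F_real (x + step i x) = opt_real" "x + step i x \<in> feasible"
proof -
  obtain xs where xs: "xs \<in> opt_solutions F" using solutions_nonempty by blast
  have U: "(UNIV :: 'n set) = {i}" using n by (metis UNIV_I card_1_singletonE singletonD)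
  have d: "full_step x = step i x" unfolding full_step_def U by simp
  then show dm: "x + step i x \<in> feasible" using full_step_feasible[of x] by simp
  have "F_real (x + step i x) \<le> model_value x"
    using f_descent[of x i] by (simp add: F_real_def model_value_def d)
  moreover have "model_value x \<le> opt_real"
  proof -
    have "1 / 2 * sqL (step i x) - ipL (step i x) (xs - x) + 1 / 2 * sqL (xs - x)
        = 1 / 2 * sqL (xs - (x + step i x))"
      by (simp add: inner_L_add_left inner_L_add_right inner_L_diff_left inner_L_diff_right inner_L_commute)
    moreover have "sqL (xs - (x + step i x)) \<ge> 0" "\<mu>\<psi> / 2 * sqL (xs - (x + step i x)) \<ge> 0"
      using nn sqL_nonneg by auto
    ultimately show ?thesis
      using model_lower_bound[OF f p opt_solution_feasible(1)[OF xs], of x]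
      unfolding d opt_solution_feasible(2)[OF xs] by linarith
  qed
  ultimately show "F_real (x + step i x) = opt_real" using opt_real_le[OF dm] by linarith
qed

end

section \<open>Convergence rates\<close>

lemma rbcd_cong:
  "(\<And>j. j < k \<Longrightarrow> \<sigma> j = \<tau> j) \<Longrightarrow> rbcd blk L f \<psi> x0 \<sigma> k = rbcd blk L f \<psi> x0 \<tau> k"
  by (induction k) (auto simp: less_Suc_eq)

locale random_block_descent = composite_problem blk L f \<psi> + prob_space M
  for blk :: "'m::finite \<Rightarrow> 'n::finite" and L f \<psi> and M :: "'w measure" +
  fixes idx :: "nat \<Rightarrow> 'w \<Rightarrow> 'n" and x0 :: "real ^ 'm"
  assumes idx_indep: "indep_vars (\<lambda>_. count_space UNIV) idx UNIV"
    and idx_uniform: "\<And>k. distr M (count_space UNIV) (idx k) = uniform_count_measure UNIV"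
begin

definition iterate :: "nat \<Rightarrow> 'w \<Rightarrow> real ^ 'm" where
  "iterate k \<omega> = rbcd blk L f \<psi> x0 (\<lambda>j. idx j \<omega>) k"

lemma iterate_0: "iterate 0 \<omega> = x0"
  by (simp add: iterate_def)

lemma iterate_Suc: "iterate (Suc k) \<omega> = iterate k \<omega> + step (idx k \<omega>) (iterate k \<omega>)"
  by (simp add: iterate_def)

lemma integrable_iterate: "integrable M (\<lambda>\<omega>. \<Phi> (iterate k \<omega>) :: real)"
  unfolding iterate_def
proof (rule integrable_finite_dependence)
  show "idx j \<in> measurable M (count_space UNIV)" for j
    using idx_indep by (simp add: indep_vars_def)
  show "\<Phi> (rbcd blk L f \<psi> x0 \<sigma> k) = \<Phi> (rbcd blk L f \<psi> x0 \<tau> k)" if "\<And>j. j < k \<Longrightarrow> \<sigma> j = \<tau> j"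
    for \<sigma> \<tau>
    using rbcd_cong[of k \<sigma> \<tau> blk L f \<psi> x0, OF that] by simp
qed

lemma expectation_iterate_Suc:
  "expectation (\<lambda>\<omega>. \<Phi> (iterate (Suc k) \<omega>))
    = expectation (\<lambda>\<omega>. (\<Sum>i\<in>UNIV. \<Phi> (iterate k \<omega> + step i (iterate k \<omega>))) / real CARD('n))"
proof -
  have "rbcd blk L f \<psi> x0 (\<sigma>(k := i)) (Suc k)
      = rbcd blk L f \<psi> x0 \<sigma> k + step i (rbcd blk L f \<psi> x0 \<sigma> k)" for \<sigma> i
    using rbcd_cong[of k "\<sigma>(k := i)" \<sigma> blk L f \<psi> x0] by simp
  moreover have "expectation (\<lambda>\<omega>. \<Phi> (rbcd blk L f \<psi> x0 (\<lambda>j. idx j \<omega>) (Suc k)))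
    = expectation (\<lambda>\<omega>. (\<Sum>i\<in>UNIV. \<Phi> (rbcd blk L f \<psi> x0 ((\<lambda>j. idx j \<omega>)(k := i)) (Suc k))) / real CARD('n))"
    by (rule expectation_average_last_index[OF idx_indep idx_uniform,
          where Z = "\<lambda>\<tau>. \<Phi> (rbcd blk L f \<psi> x0 \<tau> (Suc k))"])
      (metis rbcd_cong)
  ultimately show ?thesis unfolding iterate_def by (simp only:)
qed

lemma iterate_feasible: "x0 \<in> feasible \<Longrightarrow> iterate k \<omega> \<in> feasible"
  by (induction k) (simp_all add: iterate_0 iterate_Suc step_feasible)

lemma expectation_iterate_Suc_le:
  assumes "x0 \<in> feasible"
    and "\<And>y. y \<in> feasible \<Longrightarrow> (\<Sum>i\<in>UNIV. \<Phi> (y + step i y)) / real CARD('n) \<le> \<Phi>' y"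
  shows "expectation (\<lambda>\<omega>. \<Phi> (iterate (Suc k) \<omega>)) \<le> expectation (\<lambda>\<omega>. \<Phi>' (iterate k \<omega>))"
  unfolding expectation_iterate_Suc
  by (intro integral_mono integrable_iterate assms iterate_feasible)

text \<open>
  Every step lowers the expected potential by the expected gap divided by \<open>n\<close>. Since the expected gap
  does not increase, the \<open>k\<close> decreases so far add up to at least \<open>k/n\<close> times the current gap, which
  is the inequality proved by induction.
\<close>

lemma sublinear_rate:
  assumes x0: "x0 \<in> feasible" and xs: "xs \<in> opt_solutions F"
  shows "expectation (\<lambda>\<omega>. F_real (iterate k \<omega>)) - opt_real
    \<le> real CARD('n) / (real CARD('n) + real k) * (1 / 2 * sqL (x0 - xs) + (F_real x0 - opt_real))"
proof -
  let ?n = "real CARD('n)"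
  define V where "V y = 1 / 2 * sqL (y - xs) + (F_real y - opt_real)" for y
  define D where "D y = F_real y - opt_real" for y
  \<comment> \<open>Any function satisfies the inequality with parameter 0, by the definition of subgradients.\<close>
  have sc0: "strong_convexity_ineq blk L \<phi> 0" for \<phi>
    by (auto simp: strong_convexity_ineq_def subdifferential_def)
  have n: "?n > 0" by simp
  have E: "expectation (\<lambda>\<omega>. V (iterate k \<omega>)) + real k / ?n * expectation (\<lambda>\<omega>. D (iterate k \<omega>)) \<le> V x0"
  proof (induction k)
    case 0
    show ?case by (simp add: iterate_0 prob_space)
  next
    case (Suc k)
    have "expectation (\<lambda>\<omega>. V (iterate (Suc k) \<omega>)) \<le> expectation (\<lambda>\<omega>. V (iterate k \<omega>) - D (iterate k \<omega>) / ?n)"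
      by (rule expectation_iterate_Suc_le[OF x0, of V "\<lambda>y. V y - D y / ?n"])
        (use potential_step[OF sc0 sc0 _ xs] in \<open>simp add: V_def D_def\<close>)
    also have "\<dots> = expectation (\<lambda>\<omega>. V (iterate k \<omega>)) - expectation (\<lambda>\<omega>. D (iterate k \<omega>)) / ?n"
      by (simp add: integrable_iterate[of V] integrable_iterate[of D])
    finally have 1: "expectation (\<lambda>\<omega>. V (iterate (Suc k) \<omega>)) \<le> \<dots>" .
    have "expectation (\<lambda>\<omega>. D (iterate (Suc k) \<omega>)) \<le> expectation (\<lambda>\<omega>. D (iterate k \<omega>))"
    proof (rule expectation_iterate_Suc_le[OF x0])
      fix y assume y: "y \<in> feasible"
      have "(\<Sum>i\<in>UNIV. D (y + step i y)) \<le> (\<Sum>i\<in>(UNIV::'n set). D y)"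
        by (intro sum_mono) (simp add: D_def F_step_le[OF y])
      then show "(\<Sum>i\<in>UNIV. D (y + step i y)) / ?n \<le> D y" by (simp add: field_simps)
    qed
    then have "real (Suc k) / ?n * expectation (\<lambda>\<omega>. D (iterate (Suc k) \<omega>))
        \<le> real (Suc k) / ?n * expectation (\<lambda>\<omega>. D (iterate k \<omega>))"
      by (intro mult_left_mono) auto
    also have "\<dots> = real k / ?n * expectation (\<lambda>\<omega>. D (iterate k \<omega>)) + expectation (\<lambda>\<omega>. D (iterate k \<omega>)) / ?n"
      by (simp add: add_divide_distrib ring_distribs)
    finally show ?case using 1 Suc by linarith
  qed
  have "expectation (\<lambda>\<omega>. D (iterate k \<omega>)) \<le> expectation (\<lambda>\<omega>. V (iterate k \<omega>))"
    by (intro integral_mono integrable_iterate[of D] integrable_iterate[of V])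
      (simp add: D_def V_def sqL_nonneg)
  then have "(?n + real k) / ?n * expectation (\<lambda>\<omega>. D (iterate k \<omega>)) \<le> V x0"
    using E by (simp add: add_divide_distrib ring_distribs)
  then have "expectation (\<lambda>\<omega>. D (iterate k \<omega>)) \<le> ?n / (?n + real k) * V x0"
    using n add_pos_nonneg[OF n of_nat_0_le_iff[of k]] by (simp add: field_simps pos_le_divide_eq)
  moreover have "expectation (\<lambda>\<omega>. D (iterate k \<omega>)) = expectation (\<lambda>\<omega>. F_real (iterate k \<omega>)) - opt_real"
    by (simp add: D_def integrable_iterate[of F_real] prob_space)
  ultimately show ?thesis by (simp add: V_def)
qed

text \<open>
  The number \<open>\<beta>\<close> is \<open>n\<close> times the relative decrease of the potential per step. It reaches 1 only for
  \<open>\<mu>f = 1\<close>, so the factor \<open>1 - \<beta>/n\<close> can vanish only for a single block with \<open>\<mu>f = 1\<close>.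
\<close>

lemma rate_bounds:
  assumes "0 \<le> \<mu>f" "\<mu>f \<le> 1" "0 \<le> \<mu>\<psi>" "\<mu>f + \<mu>\<psi> > (0::real)"
  defines "\<beta> \<equiv> 2 * (\<mu>f + \<mu>\<psi>) / (1 + \<mu>f + 2 * \<mu>\<psi>)"
  shows "0 < \<beta>" "\<beta> \<le> 1" "\<beta> = 1 \<longleftrightarrow> \<mu>f = 1"
  using assms by (auto simp: field_simps)

text \<open>
  The potential contracts by \<open>1 - \<beta>/n\<close> in expectation. The decrease in \<open>potential_step\<close> is a
  combination of gap and squared distance in the wrong proportion; quadratic growth trades the
  fraction \<open>1 - \<beta>\<close> of the gap for squared distance, and \<open>\<beta>\<close> is the number for which the result is
  exactly \<open>\<beta>\<close> times the potential.
\<close>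

lemma linear_rate:
  assumes x0: "x0 \<in> feasible" and xs: "xs \<in> opt_solutions F"
    and f: "strong_convexity_ineq blk L (\<lambda>y. ereal (f y)) \<mu>f" and mf: "\<mu>f \<ge> 0"
    and p: "strong_convexity_ineq blk L \<Psi> \<mu>\<psi>" and mp: "\<mu>\<psi> \<ge> 0" and pos: "\<mu>f + \<mu>\<psi> > 0"
  shows "expectation (\<lambda>\<omega>. F_real (iterate k \<omega>)) - opt_real
    \<le> (1 - 2 * (\<mu>f + \<mu>\<psi>) / (real CARD('n) * (1 + \<mu>f + 2 * \<mu>\<psi>))) ^ k
      * ((1 + \<mu>\<psi>) / 2 * sqL (x0 - xs) + (F_real x0 - opt_real))"
proof -
  let ?n = "real CARD('n)"
  define \<beta> where "\<beta> = 2 * (\<mu>f + \<mu>\<psi>) / (1 + \<mu>f + 2 * \<mu>\<psi>)"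
  define V where "V y = (1 + \<mu>\<psi>) / 2 * sqL (y - xs) + (F_real y - opt_real)" for y
  have n: "?n \<ge> 1" by (simp add: Suc_leI)
  have b: "0 < \<beta>" "\<beta> \<le> 1"
    using rate_bounds(1,2)[OF mf convexity_parameter_f_le_1[OF f] mp pos] by (simp_all add: \<beta>_def)
  then have "\<beta> \<le> ?n" using n by linarith
  then have q: "0 \<le> 1 - \<beta> / ?n" by (simp add: divide_le_eq)
  have step_V: "(\<Sum>i\<in>UNIV. V (y + step i y)) / ?n \<le> (1 - \<beta> / ?n) * V y" if y: "y \<in> feasible" for y
  proof -
    let ?R = "sqL (y - xs)" and ?D = "F_real y - opt_real" and ?m = "(\<mu>f + \<mu>\<psi>) / 2"
    have "\<beta> * (1 + \<mu>f + 2 * \<mu>\<psi>) = 4 * ?m" using mf mp by (simp add: \<beta>_def field_simps)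
    moreover have "\<beta> * (1 + \<mu>f + 2 * \<mu>\<psi>) = 2 * (\<beta> * ((1 + \<mu>\<psi>) / 2)) + 2 * (\<beta> * ?m)"
      by (simp add: field_simps)
    ultimately have "\<beta> * ((1 + \<mu>\<psi>) / 2) = 2 * ?m - \<beta> * ?m" by linarith
    then have "\<beta> * V y = (2 * ?m - \<beta> * ?m) * ?R + \<beta> * ?D"
      unfolding V_def by (metis distrib_left mult.assoc)
    also have "\<dots> = ?m * ?R + ?D - (1 - \<beta>) * (?D - ?m * ?R)" by (simp add: field_simps)
    also have "\<dots> \<le> ?m * ?R + ?D"
      using quadratic_growth[OF f p mp xs y] b by simp
    finally have "\<beta> * V y / ?n \<le> (?m * ?R + ?D) / ?n" by (intro divide_right_mono) auto
    then show ?thesis using potential_step[OF f p y xs] unfolding V_def[symmetric]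
      by (simp add: left_diff_distrib)
  qed
  have "expectation (\<lambda>\<omega>. V (iterate k \<omega>)) \<le> (1 - \<beta> / ?n) ^ k * V x0"
  proof (induction k)
    case 0
    show ?case by (simp add: iterate_0 prob_space)
  next
    case (Suc k)
    have "expectation (\<lambda>\<omega>. V (iterate (Suc k) \<omega>)) \<le> expectation (\<lambda>\<omega>. (1 - \<beta> / ?n) * V (iterate k \<omega>))"
      by (rule expectation_iterate_Suc_le[OF x0 step_V])
    also have "\<dots> = (1 - \<beta> / ?n) * expectation (\<lambda>\<omega>. V (iterate k \<omega>))" by simp
    also have "\<dots> \<le> (1 - \<beta> / ?n) * ((1 - \<beta> / ?n) ^ k * V x0)"
      by (intro mult_left_mono Suc q)
    finally show ?case by simp
  qed
  moreover have "expectation (\<lambda>\<omega>. F_real (iterate k \<omega>) - opt_real) \<le> expectation (\<lambda>\<omega>. V (iterate k \<omega>))"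
    by (intro integral_mono integrable_iterate[of V] integrable_iterate[of "\<lambda>y. F_real y - opt_real"])
      (use mp in \<open>simp add: V_def sqL_nonneg\<close>)
  moreover have "expectation (\<lambda>\<omega>. F_real (iterate k \<omega>) - opt_real) = expectation (\<lambda>\<omega>. F_real (iterate k \<omega>)) - opt_real"
    by (simp add: integrable_iterate[of F_real] prob_space)
  moreover have "\<beta> / ?n = 2 * (\<mu>f + \<mu>\<psi>) / (?n * (1 + \<mu>f + 2 * \<mu>\<psi>))" by (simp add: \<beta>_def mult.commute)
  ultimately show ?thesis by (simp add: V_def)
qed

lemma ereal_expectation_iterate:
  assumes "x0 \<in> feasible"
  shows "ereal_expectation M (\<lambda>\<omega>. F (iterate k \<omega>)) = ereal (expectation (\<lambda>\<omega>. F_real (iterate k \<omega>)))"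
  using ereal_expectation_real[OF integrable_iterate[of F_real k]]
  by (simp add: F_eq_real[OF iterate_feasible[OF assms]])

lemma single_block_iterate_optimal:
  assumes "strong_convexity_ineq blk L (\<lambda>y. ereal (f y)) 1"
    and "strong_convexity_ineq blk L \<Psi> \<mu>\<psi>" "\<mu>\<psi> \<ge> 0" "CARD('n) = 1"
  shows "ereal_expectation M (\<lambda>\<omega>. F (iterate (Suc k) \<omega>)) = ereal opt_real"
proof -
  have "F (iterate (Suc k) \<omega>) = ereal opt_real" for \<omega>
    using single_block_exact_step[OF assms, of "iterate k \<omega>" "idx k \<omega>"]
    by (simp add: iterate_Suc F_eq_real)
  then show ?thesis using ereal_expectation_real[of M "\<lambda>_. opt_real"] by (simp add: prob_space)
qed

end

lemma bound_at_nearest_solution: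
  assumes "S \<noteq> {}" "\<And>i. L i > 0" "\<And>xs. xs \<in> S \<Longrightarrow> a \<le> c * (b * (norm_L blk L (x0 - xs))\<^sup>2 + e)"
  shows "a \<le> c * (b * (INF xs\<in>S. norm_L blk L (x0 - xs))\<^sup>2 + e)"
proof (rule le_at_Inf_of_squares)
  show "bdd_below ((\<lambda>xs. norm_L blk L (x0 - xs)) ` S)"
    using assms(2) by (auto simp: norm_L_def less_imp_le intro!: bdd_belowI2[of _ 0] sum_nonneg)
qed (use assms in auto)

theorem theorem1:
  fixes blk :: "'m::finite \<Rightarrow> 'n::finite"
    and L :: "'n \<Rightarrow> real"
    and f :: "real ^ 'm \<Rightarrow> real"
    and \<psi> :: "'n \<Rightarrow> real ^ 'm \<Rightarrow> ereal"
    and F :: "real ^ 'm \<Rightarrow> ereal"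
    and Fstar :: ereal
    and R0 :: real
    and x0 :: "real ^ 'm"
    and M :: "'w measure"
    and idx :: "nat \<Rightarrow> 'w \<Rightarrow> 'n"
    and x :: "nat \<Rightarrow> 'w \<Rightarrow> real ^ 'm"
    and n :: real
  defines "F \<equiv> objective blk f \<psi>"
    and "Fstar \<equiv> opt_value F"
    and "R0 \<equiv> (INF xs\<in>opt_solutions F. norm_L blk L (x0 - xs))"
    and "x \<equiv> (\<lambda>k \<omega>. rbcd blk L f \<psi> x0 (\<lambda>j. idx j \<omega>) k)"
    and "n \<equiv> real CARD('n)"
  assumes f_convex: "convex_on UNIV f"
    and f_diff: "f differentiable_on UNIV"
    and L_pos: "\<And>i. L i > 0"
    and f_lipschitz:
      "\<And>y i h. h \<in> block_space blk i \<Longrightarrow>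
         norm (block blk i (gradient f (y + h)) - block blk i (gradient f y)) \<le> L i * norm h"
    and psi_closed_convex: "\<And>i. closed_convex_fun_on (block_space blk i) (\<psi> i)"
    and Fstar_finite: "\<bar>Fstar\<bar> \<noteq> \<infinity>"
    and solutions_nonempty: "opt_solutions F \<noteq> {}"
    and M_prob: "prob_space M"
    and idx_indep: "prob_space.indep_vars M (\<lambda>_. count_space UNIV) idx UNIV"
    and idx_uniform: "\<And>k. distr M (count_space UNIV) (idx k) = uniform_count_measure UNIV"
  shows
    "(\<forall>k. ereal_expectation M (\<lambda>\<omega>. F (x k \<omega>)) - Fstar
           \<le> ereal (n / (n + real k)) * (ereal (1 / 2 * R0\<^sup>2) + F x0 - Fstar))
     \<and>
     (\<forall>\<mu>f \<mu>\<psi>. is_convexity_parameter blk L (\<lambda>y. ereal (f y)) \<mu>f \<longrightarrow>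
        is_convexity_parameter blk L (block_sum blk \<psi>) \<mu>\<psi> \<longrightarrow>
        \<mu>f + \<mu>\<psi> > 0 \<longrightarrow>
        (\<forall>k. ereal_expectation M (\<lambda>\<omega>. F (x k \<omega>)) - Fstar
              \<le> ereal ((1 - 2 * (\<mu>f + \<mu>\<psi>) / (n * (1 + \<mu>f + 2 * \<mu>\<psi>))) ^ k)
                 * (ereal ((1 + \<mu>\<psi>) / 2 * R0\<^sup>2) + F x0 - Fstar)))"
proof -
  interpret M: prob_space M by (rule M_prob)
  interpret random_block_descent blk L f \<psi> M idx x0
    by unfold_locales (use assms in auto)
  have x_eq: "x = iterate" by (simp add: x_def iterate_def fun_eq_iff)
  have n1: "n \<ge> 1" by (simp add: n_def Suc_leI)
  have Fstar: "Fstar = ereal opt_real" by (simp add: Fstar_def F_def opt_value_eq)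
  have sq: "sqL v = (norm_L blk L v)\<^sup>2" for v by (simp add: norm_L_sq[of L, OF L_pos])
  have F_x0: "F x0 = (if x0 \<in> feasible then ereal (F_real x0) else \<infinity>)"
    by (simp add: F_def F_eq_real F_infinite)
  have infinite_start: "a - Fstar \<le> ereal c * (ereal b + F x0 - Fstar)" if "x0 \<notin> feasible" "c > 0" for a b c
    using that by (simp add: F_x0 Fstar)
  have finite_start: "ereal_expectation M (\<lambda>\<omega>. F (x k \<omega>)) - Fstar \<le> ereal c * (ereal (b * R0\<^sup>2) + F x0 - Fstar)"
    if x0: "x0 \<in> feasible" and le: "\<And>xs. xs \<in> opt_solutions F \<Longrightarrow>
      M.expectation (\<lambda>\<omega>. F_real (iterate k \<omega>)) - opt_real \<le> c * (b * sqL (x0 - xs) + (F_real x0 - opt_real))"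
    for b c k
  proof -
    have "M.expectation (\<lambda>\<omega>. F_real (iterate k \<omega>)) - opt_real \<le> c * (b * R0\<^sup>2 + (F_real x0 - opt_real))"
      unfolding R0_def
      by (rule bound_at_nearest_solution[OF solutions_nonempty[folded F_def] L_pos]) (use le in \<open>simp add: sq\<close>)
    then show ?thesis
      using ereal_expectation_iterate[OF x0, of k] x0 by (simp add: F_x0 Fstar x_eq F_def[symmetric] add_diff_eq)
  qed
  show ?thesis
  proof (intro conjI allI impI)
    fix k
    show "ereal_expectation M (\<lambda>\<omega>. F (x k \<omega>)) - Fstar
           \<le> ereal (n / (n + real k)) * (ereal (1 / 2 * R0\<^sup>2) + F x0 - Fstar)"
    proof (cases "x0 \<in> feasible")
      case True
      show ?thesis
        by (rule finite_start[OF True]) (use sublinear_rate[OF True] in \<open>simp add: n_def F_def\<close>)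
    next
      case False
      show ?thesis by (rule infinite_start[OF False]) (use n1 in simp)
    qed
  next
    fix \<mu>f \<mu>\<psi> k
    assume pf: "is_convexity_parameter blk L (\<lambda>y. ereal (f y)) \<mu>f"
      and pp: "is_convexity_parameter blk L (block_sum blk \<psi>) \<mu>\<psi>" and pos: "\<mu>f + \<mu>\<psi> > 0"
    then have mf: "strong_convexity_ineq blk L (\<lambda>y. ereal (f y)) \<mu>f" "\<mu>f \<ge> 0"
      and mp: "strong_convexity_ineq blk L (block_sum blk \<psi>) \<mu>\<psi>" "\<mu>\<psi> \<ge> 0"
      by (simp_all add: is_convexity_parameter_def)
    let ?q = "1 - 2 * (\<mu>f + \<mu>\<psi>) / (n * (1 + \<mu>f + 2 * \<mu>\<psi>))"
    show "ereal_expectation M (\<lambda>\<omega>. F (x k \<omega>)) - Fstar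
              \<le> ereal (?q ^ k) * (ereal ((1 + \<mu>\<psi>) / 2 * R0\<^sup>2) + F x0 - Fstar)"
    proof (cases "x0 \<in> feasible")
      case True
      show ?thesis
        by (rule finite_start[OF True])
          (use linear_rate[OF True _ mf mp pos] in \<open>simp add: n_def F_def\<close>)
    next
      case False
      define \<beta> where "\<beta> = 2 * (\<mu>f + \<mu>\<psi>) / (1 + \<mu>f + 2 * \<mu>\<psi>)"
      have b: "0 < \<beta>" "\<beta> \<le> 1" "\<beta> = 1 \<longleftrightarrow> \<mu>f = 1"
        using rate_bounds[OF mf(2) convexity_parameter_f_le_1[OF mf(1)] mp(2) pos]
        by (simp_all add: \<beta>_def)
      have q: "?q = 1 - \<beta> / n" by (simp add: \<beta>_def mult.commute)
      show ?thesis
      proof (cases "?q > 0 \<or> k = 0")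
        case True
        then show ?thesis by (intro infinite_start[OF False]) auto
      next
        \<comment> \<open>The factor is 0 and \<open>F x0\<close> infinite: the right-hand side is 0, and the bound
        says that the iterate is optimal.\<close>
        case degenerate: False
        then have "n \<le> \<beta>" unfolding q using n1 by (simp add: field_simps)
        then have "n = 1" "\<beta> = 1" using n1 b by auto
        then have "\<mu>f = 1" "CARD('n) = 1" "?q = 0" using b q by (auto simp: n_def)
        moreover obtain k' where "k = Suc k'" using degenerate not0_implies_Suc by blast
        ultimately show ?thesis
          using single_block_iterate_optimal[of \<mu>\<psi> k'] mf mp
          by (simp add: x_eq F_def Fstar zero_ereal_def[symmetric])
      qed
    qed
  qed
qed

end
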